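(* Let $\Omega\subset\mathbb{R}^d$ be a compact convex set with nonempty interior and let $\mu$ be a probability measure on $\Omega$ which is absolutely continuous with respect to the Lebesgue measure with density in $L^\infty(\Omega)$. Let $V:[0,+\infty[\to[0,+\infty[$ be a $C^2$ function with $V'>0$. Then the minimization problem over $\nu\in\mathcal{P}(\Omega)$ for the functional $$\mathfrak{F}^{\mu}(\nu)=\frac12 W_2^2(\mu,\nu)+\int_{\Omega\times\Omega}V(|x-y|^2)\,\nu(dx)\,\nu(dy)$$ admits at least one solution, and any minimizer is absolutely continuous with respect to the Lebesgue measure with density in $L^\infty(\Omega)$.
   Context: $\mathcal{P}(\Omega)$ is the set of Borel probability measures on $\Omega$, and $W_2$ is the 2-Wasserstein distance: $W_2^2(\mu,\nu)=\min\{\int_{\Omega\times\Omega}|x-y|^2\,d\gamma\}$ over all $\gamma\in\mathcal{P}(\Omega\times\Omega)$ with marginals $\mu$ and $\nu$. *)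

theory Defs
  imports "HOL-Analysis.Analysis" "HOL-Probability.Probability"
begin

definition borel_probs :: "'b::topological_space set \<Rightarrow> 'b measure set" where
  "borel_probs X = {M. prob_space M \<and> sets M = sets (restrict_space borel X)}"

definition couplings ::
    "'a::euclidean_space set \<Rightarrow> 'a measure \<Rightarrow> 'a measure \<Rightarrow> ('a \<times> 'a) measure set" where
  "couplings \<Omega> \<mu> \<nu> = {\<gamma> \<in> borel_probs (\<Omega> \<times> \<Omega>).
     distr \<gamma> (restrict_space borel \<Omega>) fst = \<mu> \<and> distr \<gamma> (restrict_space borel \<Omega>) snd = \<nu>}"

(* The minimum over couplings is written as an infimum. For bounded \<Omega> and \<mu>, \<nu> in
   borel_probs \<Omega> the cost is bounded, hence integrable for every coupling, and the set
   of couplings contains the product measure, so the real Inf is the true infimum. *)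
definition W2 :: "'a::euclidean_space set \<Rightarrow> 'a measure \<Rightarrow> 'a measure \<Rightarrow> real" where
  "W2 \<Omega> \<mu> \<nu> = sqrt (INF \<gamma>\<in>couplings \<Omega> \<mu> \<nu>. \<integral>z. (norm (fst z - snd z))\<^sup>2 \<partial>\<gamma>)"

definition functional_F ::
    "'a::euclidean_space set \<Rightarrow> (real \<Rightarrow> real) \<Rightarrow> 'a measure \<Rightarrow> 'a measure \<Rightarrow> real" where
  "functional_F \<Omega> V \<mu> \<nu> =
     1 / 2 * (W2 \<Omega> \<mu> \<nu>)\<^sup>2 + (\<integral>z. V ((norm (fst z - snd z))\<^sup>2) \<partial>(\<nu> \<Otimes>\<^sub>M \<nu>))"

(* Absolute continuity with respect to Lebesgue measure on \<Omega>, with density in L^\<infinity>(\<Omega>). *)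
definition ac_with_bounded_density :: "'a::euclidean_space set \<Rightarrow> 'a measure \<Rightarrow> bool" where
  "ac_with_bounded_density \<Omega> \<nu> \<longleftrightarrow>
     absolutely_continuous (restrict_space lborel \<Omega>) \<nu> \<and>
     (\<exists>f\<in>borel_measurable (restrict_space lborel \<Omega>).
        (\<exists>C::real. AE x in restrict_space lborel \<Omega>. 0 \<le> f x \<and> f x \<le> C) \<and>
        \<nu> = density (restrict_space lborel \<Omega>) (\<lambda>x. ennreal (f x)))"

end

theory Submission
  imports Defs
begin

text \<open>
  Couplings are handled as random pairs: a coupling of \<open>\<mu>\<close> and \<open>\<nu>\<close> is the joint law of \<open>(X, Y)\<close>
  on some probability space. Minimizing \<open>functional_F\<close> over \<open>\<nu>\<close> then amounts to minimizing
  \<open>J(X, Y) = E |X - Y|\<^sup>2 / 2 + E V(|Y - Y'|\<^sup>2)\<close>, where \<open>Y'\<close> is an independent copy of \<open>Y\<close>, over all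
  \<open>\<Omega>\<close>-valued pairs in which \<open>X\<close> has law \<open>\<mu>\<close>: every such pair gives an upper bound for the
  functional at the law of \<open>Y\<close>, and an optimal coupling gives equality.

  Existence is the direct approach. Any sequence of laws on a compact convex set has a
  subsequence that is realized by random variables converging pointwise
  (\<open>prob_sequence_compact\<close>). On the real line this is Helly selection followed by Skorohod's
  representation; the higher-dimensional case is pulled back to the line by a space-filling
  curve with a Borel section. Along such a realization all costs converge by dominated
  convergence, both for couplings that nearly attain \<open>W2\<close> and for a minimizing sequence.

  For regularity, let \<open>(X, Y)\<close> realize a minimizer and put
  \<open>G(y) = y + 4 E [V'(|y - Y|\<^sup>2) (y - Y)]\<close>. The derivative of \<open>J\<close> in the direction of a
  displacement \<open>Z\<close> of \<open>Y\<close> is \<open>- E [Z \<bullet> (X - G(Y))]\<close>, so the natural competitor is the gradient step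
  \<open>Y + t (X - G(Y))\<close>. The point of the argument is that this competitor never leaves \<open>\<Omega>\<close>: the step moves
  \<open>Y\<close> towards \<open>X\<close> and, because \<open>V' \<ge> 0\<close>, towards the other points of the support, so for small
  \<open>t\<close> it is an average of convex combinations of points of \<open>\<Omega>\<close> (\<open>descent_step_in\<close>). Hence boundary points need
  no separate discussion, and minimality forces \<open>X = G(Y)\<close> almost surely
  (\<open>source_eq_of_minimal\<close>). Since \<open>V'\<close> is Lipschitz on bounded intervals, so is \<open>G\<close> on \<open>\<Omega>\<close>. If \<open>Y\<close> lies in
  a cube of side \<open>h\<close>, then \<open>X\<close> lies in a cube of side proportional to \<open>h\<close>, whose \<open>\<mu>\<close>-mass is at most
  a constant times \<open>h ^ DIM('a)\<close>. Covering by small cubes bounds the law of \<open>Y\<close> by a multiple of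
  Lebesgue measure, and the Radon-Nikodym theorem gives the bounded density.
\<close>

section \<open>A space-filling curve with a Borel section\<close>

text \<open>
  A continuous function of period 2 that is 0 on \<open>[0, 1/3]\<close> and 1 on \<open>[2/3, 1]\<close>. Applied to
  \<open>3 ^ m * s\<close> it reads off the \<open>m\<close>-th ternary digit of a point \<open>s\<close> of the Cantor set. This is the
  building block of Schoenberg's space-filling curve.
\<close>
definition ramp :: "real \<Rightarrow> real" where
  "ramp t = max 0 (min 1 (1/2 - cos (pi * t)))"

definition binary_digit :: "nat \<Rightarrow> real \<Rightarrow> int" where
  "binary_digit k x = \<lfloor>2 ^ Suc k * x\<rfloor> mod 2"

text \<open>
  For digits \<open>c k\<close> in \<open>{0, 1}\<close>, the point of the Cantor set with ternary digits \<open>2 * c k\<close>.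
\<close>
definition ternary :: "(nat \<Rightarrow> int) \<Rightarrow> real" where
  "ternary c = (\<Sum>k. 2 * real_of_int (c k) / 3 ^ Suc k)"

lemma binary_digit_range: "binary_digit k x \<in> {0, 1}"
  unfolding binary_digit_def by auto

lemma binary_digit_sums:
  assumes "0 \<le> x" "x < 1"
  shows "(\<lambda>k. real_of_int (binary_digit k x) / 2 ^ Suc k) sums x"
proof -
  have partial: "(\<Sum>k<n. real_of_int (binary_digit k x) / 2 ^ Suc k) = \<lfloor>2 ^ n * x\<rfloor> / 2 ^ n" for n
  proof (induction n)
    case 0
    have "\<lfloor>x\<rfloor> = 0" using assms by (simp add: floor_eq_iff)
    then show ?case by simp
  next
    case (Suc n)
    have "\<lfloor>2 ^ Suc n * x\<rfloor> div 2 = \<lfloor>2 ^ n * x\<rfloor>"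
      using floor_divide_real_eq_div[of 2 "2 ^ Suc n * x"] by simp
    then have "real_of_int (binary_digit n x) = \<lfloor>2 ^ Suc n * x\<rfloor> - 2 * \<lfloor>2 ^ n * x\<rfloor>"
      unfolding binary_digit_def
      by (metis minus_mult_div_eq_mod of_int_diff of_int_mult of_int_numeral)
    with Suc show ?case by (simp add: field_simps)
  qed
  have "(\<lambda>n. \<lfloor>2 ^ n * x\<rfloor> / 2 ^ n) \<longlonglongrightarrow> x"
  proof (rule tendsto_sandwich)
    show "\<forall>\<^sub>F n in sequentially. x - (1/2) ^ n \<le> \<lfloor>2 ^ n * x\<rfloor> / 2 ^ n"
    proof (intro always_eventually allI)
      fix n :: nat
      have "2 ^ n * x - 1 \<le> \<lfloor>2 ^ n * x\<rfloor>" by linarith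
      then have "(2 ^ n * x - 1) / 2 ^ n \<le> \<lfloor>2 ^ n * x\<rfloor> / 2 ^ n"
        by (intro divide_right_mono) auto
      then show "x - (1/2) ^ n \<le> \<lfloor>2 ^ n * x\<rfloor> / 2 ^ n"
        by (simp add: diff_divide_distrib power_one_over)
    qed
    show "\<forall>\<^sub>F n in sequentially. \<lfloor>2 ^ n * x\<rfloor> / 2 ^ n \<le> x"
      by (intro always_eventually allI) (simp add: divide_le_eq mult.commute)
    show "(\<lambda>n. x - (1/2) ^ n) \<longlonglongrightarrow> x"
      by (rule tendsto_eq_intros tendsto_const LIMSEQ_power_zero | simp)+
  qed auto
  then show ?thesis unfolding sums_def partial .
qed

lemma ternary_summable:
  assumes "\<And>k. c k \<in> {0, 1}"
  shows "summable (\<lambda>k. 2 * real_of_int (c k) / 3 ^ Suc k)"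
proof (rule summable_comparison_test')
  show "summable (\<lambda>k. (1/3) ^ k :: real)" by (rule summable_geometric) simp
  fix k :: nat
  have "real_of_int (c k) \<le> 1" "0 \<le> real_of_int (c k)"
    using assms[of k] by auto
  then show "norm (2 * real_of_int (c k) / 3 ^ Suc k) \<le> (1/3) ^ k"
    by (simp add: power_one_over field_simps)
qed

lemma ternary_range:
  assumes "\<And>k. c k \<in> {0, 1}"
  shows "0 \<le> ternary c \<and> ternary c \<le> 1"
proof
  have c: "real_of_int (c k) \<le> 1" "0 \<le> real_of_int (c k)" for k
    using assms[of k] by auto
  show "0 \<le> ternary c"
    unfolding ternary_def by (rule suminf_nonneg[OF ternary_summable[OF assms]]) (use c in auto)
  have geo: "(\<lambda>k. (1/3) ^ k * (2/3) :: real) sums 1"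
    using geometric_sums[of "1/3::real", THEN sums_mult2, of "2/3"] by simp
  have "ternary c \<le> (\<Sum>k. (1/3) ^ k * (2/3))"
    unfolding ternary_def
  proof (rule suminf_le[OF _ ternary_summable[OF assms] sums_summable[OF geo]])
    show "2 * real_of_int (c k) / 3 ^ Suc k \<le> (1/3) ^ k * (2/3)" for k
      using c[of k] by (simp add: power_one_over field_simps)
  qed
  then show "ternary c \<le> 1" using sums_unique[OF geo] by simp
qed

text \<open>
  Multiplication by 3 moves one ternary digit in front of the point; iterated, this is what makes
  \<open>ramp\<close> a digit reader.
\<close>
lemma ternary_shift:
  assumes "\<And>k. c k \<in> {0, 1}"
  shows "3 * ternary c = 2 * c 0 + ternary (\<lambda>k. c (Suc k))"
proof -
  have "ternary (\<lambda>k. c (Suc k)) / 3 = (\<Sum>k. 2 * real_of_int (c (Suc k)) / 3 ^ Suc (Suc k))"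
    unfolding ternary_def
    using suminf_divide[OF ternary_summable[of "\<lambda>k. c (Suc k)"], of 3] assms
    by (simp add: field_simps)
  also have "\<dots> = ternary c - 2 * c 0 / 3"
    unfolding ternary_def using suminf_split_head[OF ternary_summable[OF assms]] by simp
  finally show ?thesis by simp
qed

text \<open>
  Multiplying by \<open>3 ^ m\<close> turns the first \<open>m\<close> digits, each 0 or 2, into an even integer, which
  the period of \<open>ramp\<close> absorbs. What remains lies in \<open>[0, 1/3]\<close> or in \<open>[2/3, 1]\<close> according to digit \<open>m\<close>.
\<close>
lemma ramp_ternary:
  assumes c: "\<And>k. c k \<in> {0, 1}"
  shows "ramp (3 ^ m * ternary c) = c m"
proof -
  have "\<exists>i::int. 3 ^ m * ternary c = 2 * real_of_int i + ternary (\<lambda>k. c (k + m))"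
  proof (induction m)
    case 0
    show ?case by (intro exI[of _ 0]) simp
  next
    case (Suc m)
    then obtain i :: int where i: "3 ^ m * ternary c = 2 * real_of_int i + ternary (\<lambda>k. c (k + m))" by blast
    have "3 ^ Suc m * ternary c = 2 * real_of_int (3 * i + c m) + ternary (\<lambda>k. c (k + Suc m))"
      using i ternary_shift[of "\<lambda>k. c (k + m)"] c by simp
    then show ?case by blast
  qed
  then obtain i :: int where i: "3 ^ m * ternary c = 2 * real_of_int i + ternary (\<lambda>k. c (k + m))" by blast
  define v where "v = ternary (\<lambda>k. c (Suc k + m))"
  have v: "0 \<le> v" "v \<le> 1" using ternary_range[of "\<lambda>k. c (Suc k + m)"] c by (auto simp: v_def)
  have u: "ternary (\<lambda>k. c (k + m)) = (2 * c m + v) / 3"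
    using ternary_shift[of "\<lambda>k. c (k + m)"] c by (simp add: v_def)
  have cos: "cos (pi * (3 ^ m * ternary c)) = cos (pi * ((2 * c m + v) / 3))"
  proof -
    have "cos (pi * (3 ^ m * ternary c)) = cos (pi * ((2 * c m + v) / 3) + 2 * pi * real_of_int i)"
      unfolding i u by (simp add: algebra_simps)
    then show ?thesis by (simp add: cos_add cos_int_2pin sin_int_2pin)
  qed
  show ?thesis
  proof (cases "c m = 0")
    case True
    have "cos (pi / 3) \<le> cos (pi * (v / 3))"
      by (rule cos_monotone_0_pi_le) (use v in \<open>auto simp: field_simps\<close>)
    with True show ?thesis by (simp add: ramp_def cos cos_60)
  next
    case False
    then have c1: "c m = 1" using c[of m] by auto
    have "pi * (2 + v) / 3 \<le> pi" using v pi_gt_zero by (simp add: field_simps)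
    then have "cos (pi * ((2 + v) / 3)) \<le> cos (2 * pi / 3)"
      by (intro cos_monotone_0_pi_le) (use v in \<open>auto simp: field_simps\<close>)
    moreover have "cos (2 * pi / 3) = - (1/2)"
      using cos_120 by simp
    ultimately show ?thesis using c1 by (simp add: ramp_def cos)
  qed
qed

lemma continuous_ramp: "continuous_on UNIV ramp"
  unfolding ramp_def by (intro continuous_intros)

lemma ramp_range: "0 \<le> ramp t" "ramp t \<le> 1"
  unfolding ramp_def by auto

lemma continuous_ramp_series:
  "continuous_on UNIV (\<lambda>t. \<Sum>k. ramp (3 ^ n k * t) / 2 ^ Suc k)"
proof (rule uniform_limit_theorem)
  show "uniform_limit UNIV (\<lambda>N t. \<Sum>k<N. ramp (3 ^ n k * t) / 2 ^ Suc k)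
          (\<lambda>t. \<Sum>k. ramp (3 ^ n k * t) / 2 ^ Suc k) sequentially"
  proof (rule Weierstrass_m_test)
    show "summable (\<lambda>k. (1/2) ^ k :: real)" by (rule summable_geometric) simp
    show "norm (ramp (3 ^ n k * t) / 2 ^ Suc k) \<le> (1/2) ^ k" for k t
      using ramp_range[of "3 ^ n k * t"] by (simp add: power_one_over field_simps)
  qed
  show "\<forall>\<^sub>F N in sequentially. continuous_on UNIV (\<lambda>t. \<Sum>k<N. ramp (3 ^ n k * t) / 2 ^ Suc k)"
    by (intro always_eventually allI continuous_intros continuous_on_compose2[OF continuous_ramp]) auto
qed auto

text \<open>
  Schoenberg's curve. The section \<open>s\<close> interleaves the binary digits of the rescaled coordinates of
  \<open>x\<close> into one ternary expansion; the curve reads them back coordinate by coordinate. The nearest-point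
  projection onto \<open>K\<close> makes the curve stay in \<open>K\<close> without disturbing the points that are already there.
  The curve is continuous, so it transports convergence from the line to \<open>K\<close>, whereas the section
  only has to be measurable, since it is used to push measures to the line.
\<close>
lemma space_filling_curve:
  fixes K :: "'b::euclidean_space set"
  assumes "compact K" "convex K" "K \<noteq> {}"
  obtains \<phi> :: "real \<Rightarrow> 'b" and s :: "'b \<Rightarrow> real"
  where "continuous_on UNIV \<phi>" "\<And>t. \<phi> t \<in> K"
    "s \<in> borel_measurable borel" "\<And>x. 0 \<le> s x \<and> s x \<le> 1" "\<And>x. x \<in> K \<Longrightarrow> \<phi> (s x) = x"
proof -
  let ?d = "DIM('b)"
  obtain e where e: "bij_betw e {0..<?d} (Basis :: 'b set)"
    using ex_bij_betw_nat_finite[OF finite_Basis] by blast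
  obtain R where R: "R > 0" "\<And>x. x \<in> K \<Longrightarrow> norm x < R"
    using compact_imp_bounded[OF assms(1)] bounded_pos_less by blast
  define u where "u x j = x \<bullet> e j / (2 * R) + 1 / 2" for x j
  \<comment> \<open>Digit \<open>m\<close> of the code is binary digit \<open>m div d\<close> of coordinate \<open>m mod d\<close>. The rescaling by \<open>2 R\<close> puts
    all coordinates strictly below 1, where the binary expansion by floors is exact.\<close>
  define c where "c x m = binary_digit (m div ?d) (u x (m mod ?d))" for x m
  define s where "s x = ternary (c x)" for x
  define \<psi> where "\<psi> j t = (\<Sum>k. ramp (3 ^ (k * ?d + j) * t) / 2 ^ Suc k)" for j t
  define \<phi> where
    "\<phi> t = closest_point K (\<Sum>j\<in>{0..<?d}. (2 * R * (\<psi> j t - 1 / 2)) *\<^sub>R e j)" for t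
  have c01: "c x k \<in> {0, 1}" for x k
    unfolding c_def by (rule binary_digit_range)
  have cont_\<psi>: "continuous_on UNIV (\<psi> j)" for j
    unfolding \<psi>_def by (rule continuous_ramp_series)
  show thesis
  proof
    show "continuous_on UNIV \<phi>"
      unfolding \<phi>_def
      by (rule continuous_on_compose2[OF continuous_on_closest_point[of K UNIV]])
        (auto intro!: continuous_intros cont_\<psi> simp: assms compact_imp_closed)
    show "\<phi> t \<in> K" for t
      unfolding \<phi>_def using closest_point_exists(1) assms compact_imp_closed by blast
    show "s \<in> borel_measurable borel"
      unfolding s_def ternary_def c_def binary_digit_def u_def by measurable
    show "0 \<le> s x \<and> s x \<le> 1" for x
      unfolding s_def using ternary_range[OF c01] .
    fix x assume x: "x \<in> K"
    have \<psi>: "\<psi> j (s x) = u x j" if j: "j < ?d" for j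
    proof -
      have "e j \<in> Basis" using bij_betwE[OF e] j by auto
      then have "\<bar>x \<bullet> e j\<bar> < R" using Basis_le_norm R(2)[OF x] order_le_less_trans by blast
      then have "0 \<le> u x j" "u x j < 1" using R(1) by (auto simp: u_def field_simps)
      note sums_unique[OF binary_digit_sums[OF this]]
      moreover have "ramp (3 ^ (k * ?d + j) * s x) = binary_digit k (u x j)" for k
        unfolding s_def ramp_ternary[OF c01] using j by (simp add: c_def)
      ultimately show ?thesis by (simp add: \<psi>_def)
    qed
    have "(\<Sum>j\<in>{0..<?d}. (2 * R * (\<psi> j (s x) - 1 / 2)) *\<^sub>R e j) = (\<Sum>j\<in>{0..<?d}. (x \<bullet> e j) *\<^sub>R e j)"
      using R(1) by (intro sum.cong) (auto simp: \<psi> u_def)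
    also have "\<dots> = (\<Sum>b\<in>Basis. (x \<bullet> b) *\<^sub>R b)"
      by (rule sum.reindex_bij_betw[OF e])
    finally show "\<phi> (s x) = x"
      unfolding \<phi>_def using x by (simp add: euclidean_representation closest_point_self)
  qed
qed

section \<open>Compactness of sequences of laws\<close>

text \<open>
  Prokhorov's theorem and Skorohod's representation on a compact convex set in one statement.
  The section pushes the laws to \<open>[0, 1]\<close>, where they are tight; the curve maps the converging real
  random variables back.
\<close>
lemma prob_sequence_compact:
  fixes M :: "nat \<Rightarrow> 'b::euclidean_space measure" and K :: "'b set"
  assumes K: "compact K" "convex K" "K \<noteq> {}"
    and M: "\<And>n. prob_space (M n)" "\<And>n. sets (M n) = sets borel" "\<And>n. AE x in M n. x \<in> K"
  obtains r :: "nat \<Rightarrow> nat" and P :: "real measure" and Z Z\<^sub>0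
  where "strict_mono r" "prob_space P"
    "\<And>n. Z n \<in> borel_measurable P" "Z\<^sub>0 \<in> borel_measurable P"
    "\<And>n \<omega>. Z n \<omega> \<in> K" "\<And>\<omega>. Z\<^sub>0 \<omega> \<in> K"
    "\<And>n. distr P borel (Z n) = M (r n)"
    "\<And>\<omega>. \<omega> \<in> space P \<Longrightarrow> (\<lambda>n. Z n \<omega>) \<longlonglongrightarrow> Z\<^sub>0 \<omega>"
proof -
  obtain \<phi> :: "real \<Rightarrow> 'b" and s :: "'b \<Rightarrow> real" where
    \<phi>: "continuous_on UNIV \<phi>" "\<And>t. \<phi> t \<in> K" and s[measurable]: "s \<in> borel_measurable borel"
    and s01: "\<And>x. 0 \<le> s x \<and> s x \<le> 1" and \<phi>s: "\<And>x. x \<in> K \<Longrightarrow> \<phi> (s x) = x"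
    using space_filling_curve[OF K] by blast
  have \<phi>_meas[measurable]: "\<phi> \<in> borel_measurable borel"
    using \<phi>(1) by (rule borel_measurable_continuous_onI)
  have sM[measurable]: "s \<in> borel_measurable (M n)" for n
    using s M(2)[of n] measurable_cong_sets by blast
  define N where "N n = distr (M n) borel s" for n
  have rd: "real_distribution (N n)" for n
    unfolding N_def by (rule prob_space.real_distribution_distr[OF M(1)]) measurable
  have "measure (N n) {-1<..1} = 1" for n
  proof -
    have neg1: "- 1 < s x" for x using s01[of x] by linarith
    have "s -` {-1<..1} \<inter> space (M n) = space (M n)"
      using neg1 s01 by auto
    then show ?thesis
      unfolding N_def using prob_space.prob_space[OF M(1)[of n]]
      by (subst measure_distr) (auto simp: sM)
  qed
  then have "tight N"
    unfolding tight_def using rd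
    by (auto simp del: ex_simps) (rule exI[of _ "-1"], rule exI[of _ 1], simp)
  from tight_imp_convergent_subsubsequence[OF this, of id]
  obtain r L where r: "strict_mono r" and L: "real_distribution L" "weak_conv_m (N \<circ> r) L"
    by (auto simp: strict_mono_def)
  obtain P :: "real measure" and Y Y\<^sub>0 where P: "prob_space P"
    and Y[measurable]: "\<And>n. Y n \<in> borel_measurable P" and dY: "\<And>n. distr P borel (Y n) = (N \<circ> r) n"
    and Y\<^sub>0: "Y\<^sub>0 \<in> measurable P lborel"
    and lim: "\<And>\<omega>. \<omega> \<in> space P \<Longrightarrow> (\<lambda>n. Y n \<omega>) \<longlonglongrightarrow> Y\<^sub>0 \<omega>"
    using Skorohod[of "N \<circ> r" L] rd L by (metis comp_apply)
  have [measurable]: "Y\<^sub>0 \<in> borel_measurable P" using Y\<^sub>0 by simp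
  show thesis
  proof
    show "strict_mono r" "prob_space P" by fact+
    show "(\<lambda>\<omega>. \<phi> (Y n \<omega>)) \<in> borel_measurable P" for n by measurable
    show "(\<lambda>\<omega>. \<phi> (Y\<^sub>0 \<omega>)) \<in> borel_measurable P" by measurable
    show "\<phi> (Y n \<omega>) \<in> K" "\<phi> (Y\<^sub>0 \<omega>) \<in> K" for n \<omega> by (rule \<phi>(2))+
    show "(\<lambda>n. \<phi> (Y n \<omega>)) \<longlonglongrightarrow> \<phi> (Y\<^sub>0 \<omega>)" if "\<omega> \<in> space P" for \<omega>
      using \<phi>(1) lim[OF that] by (auto intro: isCont_tendsto_compose simp: continuous_on_eq_continuous_at)
    fix n
    have "distr P borel (\<lambda>\<omega>. \<phi> (Y n \<omega>)) = distr (distr P borel (Y n)) borel \<phi>"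
      by (simp add: distr_distr comp_def)
    also have "\<dots> = distr (M (r n)) borel (\<lambda>x. \<phi> (s x))"
      unfolding dY by (simp add: N_def distr_distr comp_def)
    also have "\<dots> = distr (M (r n)) (M (r n)) (\<lambda>x. x)"
    proof (rule distr_cong_AE)
      show "AE x in M (r n). \<phi> (s x) = x" using M(3)[of "r n"] by eventually_elim (rule \<phi>s)
    qed (use M(2)[of "r n"] in \<open>auto intro: measurable_compose[OF _ \<phi>_meas]\<close>)
    finally show "distr P borel (\<lambda>\<omega>. \<phi> (Y n \<omega>)) = M (r n)" by simp
  qed
qed

text \<open>
  Indicators of closed sets are decreasing limits of continuous functions, and the closed sets
  are an intersection-stable generator of the Borel sets.
\<close>
lemma prob_eq_if_continuous_integrals_eq:
  fixes M N :: "'b::metric_space measure"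
  assumes M: "prob_space M" "sets M = sets borel" and N: "prob_space N" "sets N = sets borel"
    and eq: "\<And>f::'b \<Rightarrow> real. continuous_on UNIV f \<Longrightarrow> (\<And>x. 0 \<le> f x \<and> f x \<le> 1) \<Longrightarrow>
               integral\<^sup>L M f = integral\<^sup>L N f"
  shows "M = N"
proof (rule measure_eqI_generator_eq[where E = "{C. closed C}" and \<Omega> = UNIV and A = "\<lambda>_. UNIV"])
  show "Int_stable {C::'b set. closed C}" by (auto simp: Int_stable_def)
  show "sets M = sigma_sets UNIV {C. closed C}" "sets N = sigma_sets UNIV {C. closed C}"
    using M(2) N(2) by (simp_all add: borel_eq_closed)
  show "emeasure M UNIV \<noteq> \<infinity>"
    using prob_space.finite_measure[OF M(1)] finite_measure.emeasure_finite by auto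
  fix C :: "'b set" assume "C \<in> {C. closed C}"
  then have C: "closed C" by simp
  show "emeasure M C = emeasure N C"
  proof (cases "C = {}")
    case False
    define f where "f k x = max 0 (1 - real k * infdist x C)" for k :: nat and x
    have cont: "continuous_on UNIV (f k)" for k
      unfolding f_def by (intro continuous_intros)
    have f01: "0 \<le> f k x \<and> f k x \<le> 1" for k x
      unfolding f_def by (auto simp: infdist_nonneg)
    have ptw: "(\<lambda>k. f k x) \<longlonglongrightarrow> indicator C x" for x
    proof (cases "x \<in> C")
      case True then show ?thesis by (simp add: f_def)
    next
      case nin: False
      then have pos: "infdist x C > 0" using infdist_pos_not_in_closed C False by blast
      obtain k0 :: nat where k0: "1 / infdist x C < real k0" using reals_Archimedean2 by blast
      have "f k x = 0" if "k \<ge> k0" for k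
      proof -
        have "1 / infdist x C \<le> real k" using k0 that by linarith
        then have "1 \<le> real k * infdist x C" using pos by (simp add: field_simps)
        then show ?thesis by (simp add: f_def)
      qed
      then have "(\<lambda>k. f k x) \<longlonglongrightarrow> 0"
        by (intro tendsto_eventually) (auto simp: eventually_sequentially)
      then show ?thesis using nin by simp
    qed
    have conv: "(\<lambda>k. integral\<^sup>L Q (f k)) \<longlonglongrightarrow> measure Q C"
      if Q: "prob_space Q" "sets Q = sets borel" for Q
    proof -
      interpret prob_space Q by fact
      have sp: "space Q = UNIV" using sets_eq_imp_space_eq[OF Q(2)] by simp
      have C': "C \<in> sets Q" using C Q(2) by simp
      have "f k \<in> borel_measurable borel" for k
        using borel_measurable_continuous_onI[OF cont] .
      then have fk: "f k \<in> borel_measurable Q" for k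
        using Q(2) measurable_cong_sets by blast
      have "(\<lambda>k. integral\<^sup>L Q (f k)) \<longlonglongrightarrow> integral\<^sup>L Q (indicator C)"
        by (rule integral_dominated_convergence[where w = "\<lambda>_. 1"]) (use fk C' ptw f01 in auto)
      then show ?thesis using C' by (simp add: sp)
    qed
    have "measure M C = measure N C"
      using LIMSEQ_unique[OF conv[OF M]] conv[OF N] eq[OF cont f01] by simp
    then show ?thesis
      by (simp add: finite_measure.emeasure_eq_measure prob_space.finite_measure M(1) N(1))
  qed simp
qed auto

text \<open>
  Keeps the marginals of couplings under limits: a constant law passes to the pointwise limit.
\<close>
lemma law_of_pointwise_limit:
  fixes X :: "nat \<Rightarrow> 'c \<Rightarrow> 'b::metric_space"
  assumes P: "prob_space P" and X[measurable]: "\<And>n. X n \<in> borel_measurable P"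
    and X\<^sub>0[measurable]: "X\<^sub>0 \<in> borel_measurable P"
    and lim: "\<And>\<omega>. \<omega> \<in> space P \<Longrightarrow> (\<lambda>n. X n \<omega>) \<longlonglongrightarrow> X\<^sub>0 \<omega>"
    and law: "\<And>n. distr P borel (X n) = M"
  shows "distr P borel X\<^sub>0 = M"
proof (rule prob_eq_if_continuous_integrals_eq)
  interpret prob_space P by fact
  show "prob_space (distr P borel X\<^sub>0)" by (rule prob_space_distr) measurable
  show "prob_space M" unfolding law[of 0, symmetric] by (rule prob_space_distr) measurable
  show "sets M = sets borel" unfolding law[of 0, symmetric] by simp
  fix f :: "'b \<Rightarrow> real" assume f: "continuous_on UNIV f" "\<And>x. 0 \<le> f x \<and> f x \<le> 1"
  have [measurable]: "f \<in> borel_measurable borel" by (rule borel_measurable_continuous_onI[OF f(1)])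
  have "(\<lambda>n. \<integral>\<omega>. f (X n \<omega>) \<partial>P) \<longlonglongrightarrow> (\<integral>\<omega>. f (X\<^sub>0 \<omega>) \<partial>P)"
  proof (rule integral_dominated_convergence[where w = "\<lambda>_. 1"])
    show "AE \<omega> in P. (\<lambda>n. f (X n \<omega>)) \<longlonglongrightarrow> f (X\<^sub>0 \<omega>)"
      using f(1) lim by (auto intro!: AE_I2 intro: isCont_tendsto_compose simp: continuous_on_eq_continuous_at)
  qed (use f(2) in auto)
  moreover have "(\<integral>\<omega>. f (X n \<omega>) \<partial>P) = integral\<^sup>L M f" for n
    unfolding law[of n, symmetric] by (simp add: integral_distr)
  ultimately have "(\<integral>\<omega>. f (X\<^sub>0 \<omega>) \<partial>P) = integral\<^sup>L M f"
    by (simp add: LIMSEQ_const_iff)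
  then show "integral\<^sup>L (distr P borel X\<^sub>0) f = integral\<^sup>L M f" by (simp add: integral_distr)
qed simp

section \<open>Couplings as random pairs\<close>

text \<open>
  Membership in \<open>\<Omega>\<close> is demanded everywhere, and the variables are measurable into the whole space, so that
  sums, limits and compositions can be formed without restricted sigma-algebras. The law of \<open>Y\<close> is
  left free: it plays the role of the competitor measure.
\<close>
definition transport_pair :: "'a::euclidean_space set \<Rightarrow> 'a measure \<Rightarrow> 'c measure \<Rightarrow> ('c \<Rightarrow> 'a) \<Rightarrow> ('c \<Rightarrow> 'a) \<Rightarrow> bool"
  where "transport_pair \<Omega> \<mu> P X Y \<longleftrightarrow>
    prob_space P \<and> X \<in> borel_measurable P \<and> Y \<in> borel_measurable P \<and>
    (\<forall>\<omega>. X \<omega> \<in> \<Omega> \<and> Y \<omega> \<in> \<Omega>) \<and> distr P (restrict_space borel \<Omega>) X = \<mu>"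

definition plan_cost :: "(real \<Rightarrow> real) \<Rightarrow> 'c measure \<Rightarrow> ('c \<Rightarrow> 'a::euclidean_space) \<Rightarrow> ('c \<Rightarrow> 'a) \<Rightarrow> real"
  where "plan_cost V P X Y = 1 / 2 * (\<integral>\<omega>. (norm (X \<omega> - Y \<omega>))\<^sup>2 \<partial>P) +
    (\<integral>z. V ((norm (Y (fst z) - Y (snd z)))\<^sup>2) \<partial>(P \<Otimes>\<^sub>M P))"

lemma borel_measurable_restrictI:
  assumes "X \<in> borel_measurable P" "\<And>\<omega>. X \<omega> \<in> \<Omega>"
  shows "X \<in> measurable P (restrict_space borel \<Omega>)"
  using assms by (intro measurable_restrict_space2) auto

lemma measurable_id_restrict_borel:
  assumes "sets \<gamma> = sets (restrict_space borel K)"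
  shows "(\<lambda>x. x) \<in> measurable \<gamma> borel"
  using assms measurable_ident by (metis measurable_cong_sets measurable_ident_sets measurable_restrict_space1)

lemma borel_measurable_projections:
  "fst \<in> borel_measurable (borel :: ('a::topological_space \<times> 'a) measure)"
  "snd \<in> borel_measurable (borel :: ('a \<times> 'a) measure)"
  by (auto intro!: borel_measurable_continuous_onI continuous_intros)

lemma measurable_projections_restrict:
  fixes A B :: "'a::euclidean_space set"
  shows "fst \<in> measurable (restrict_space borel (A \<times> B)) (restrict_space borel A)"
    and "snd \<in> measurable (restrict_space borel (A \<times> B)) (restrict_space borel B)"
proof -
  show "fst \<in> measurable (restrict_space borel (A \<times> B)) (restrict_space borel A)"
    "snd \<in> measurable (restrict_space borel (A \<times> B)) (restrict_space borel B)"
    using borel_measurable_projections[where 'a='a]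
    by (intro measurable_restrict_space2 measurable_restrict_space1; fastforce simp: space_restrict_space)+
qed

lemma distr_restrict_borel:
  assumes \<gamma>: "sets \<gamma> = sets (restrict_space borel K)" and X: "X \<in> borel_measurable P" "\<And>\<omega>. X \<omega> \<in> K"
    and eq: "distr P borel X = distr \<gamma> borel (\<lambda>x. x)"
  shows "distr P (restrict_space borel K) X = \<gamma>"
proof (rule measure_eqI)
  fix A assume "A \<in> sets (distr P (restrict_space borel K) X)"
  then have A: "A \<in> sets (restrict_space borel K)" by simp
  then obtain B where B: "B \<in> sets borel" "A = B \<inter> K" 
    by (auto simp: sets_restrict_space)
  have sp: "space \<gamma> = K" using sets_eq_imp_space_eq[OF \<gamma>] by (simp add: space_restrict_space)
  have "emeasure (distr P (restrict_space borel K) X) A = emeasure P (X -` A \<inter> space P)"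
    using A borel_measurable_restrictI[OF X] by (simp add: emeasure_distr)
  also have "X -` A \<inter> space P = X -` B \<inter> space P" using B X by auto
  also have "emeasure P \<dots> = emeasure (distr P borel X) B"
    using X B by (simp add: emeasure_distr)
  also have "\<dots> = emeasure \<gamma> A"
    unfolding eq using measurable_id_restrict_borel[OF \<gamma>] B sp by (simp add: emeasure_distr)
  finally show "emeasure (distr P (restrict_space borel K) X) A = emeasure \<gamma> A" .
qed (simp add: \<gamma>)

lemma distr_borel_restrict:
  assumes "X \<in> borel_measurable P" "\<And>\<omega>. X \<omega> \<in> K"
  shows "distr P borel X = distr (distr P (restrict_space borel K) X) borel (\<lambda>x. x)"
  using borel_measurable_restrictI[OF assms]
  by (subst distr_distr) (auto simp: comp_def intro: measurable_restrict_space1)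

text \<open>
  The product measure shows that the infimum defining \<open>W2\<close> is taken over a nonempty set.
\<close>
lemma product_coupling:
  fixes \<Omega> :: "'a::euclidean_space set"
  assumes \<mu>: "\<mu> \<in> borel_probs \<Omega>" and \<nu>: "\<nu> \<in> borel_probs \<Omega>"
  shows "couplings \<Omega> \<mu> \<nu> \<noteq> {}"
proof -
  interpret \<mu>: prob_space \<mu> using \<mu> by (simp add: borel_probs_def)
  interpret \<nu>: prob_space \<nu> using \<nu> by (simp add: borel_probs_def)
  interpret pair_prob_space \<mu> \<nu> by unfold_locales
  have sets: "sets \<mu> = sets (restrict_space borel \<Omega>)" "sets \<nu> = sets (restrict_space borel \<Omega>)"
    using \<mu> \<nu> by (auto simp: borel_probs_def)
  then have sp: "space \<mu> = \<Omega>" "space \<nu> = \<Omega>"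
    by (auto dest!: sets_eq_imp_space_eq simp: space_restrict_space)
  have [measurable]: "fst \<in> borel_measurable (\<mu> \<Otimes>\<^sub>M \<nu>)" "snd \<in> borel_measurable (\<mu> \<Otimes>\<^sub>M \<nu>)"
    using measurable_compose[OF measurable_fst measurable_id_restrict_borel[OF sets(1)], of \<nu>]
      measurable_compose[OF measurable_snd measurable_id_restrict_borel[OF sets(2)], of \<mu>]
    by (simp_all)
  have id: "(\<lambda>z. z) \<in> measurable (\<mu> \<Otimes>\<^sub>M \<nu>) (restrict_space borel (\<Omega> \<times> \<Omega>))"
  proof (rule measurable_restrict_space2)
    have "(\<lambda>z. (fst z, snd z)) \<in> borel_measurable (\<mu> \<Otimes>\<^sub>M \<nu>)" by measurable
    then show "(\<lambda>z. z) \<in> borel_measurable (\<mu> \<Otimes>\<^sub>M \<nu>)" by simp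
  qed (auto simp: space_pair_measure sp)
  define \<gamma> where "\<gamma> = distr (\<mu> \<Otimes>\<^sub>M \<nu>) (restrict_space borel (\<Omega> \<times> \<Omega>)) (\<lambda>z. z)"
  have fs: "fst \<in> measurable (restrict_space borel (\<Omega> \<times> \<Omega>)) (restrict_space borel \<Omega>)"
    "snd \<in> measurable (restrict_space borel (\<Omega> \<times> \<Omega>)) (restrict_space borel \<Omega>)"
    by (rule measurable_projections_restrict)+
  have "distr \<gamma> (restrict_space borel \<Omega>) fst = distr (\<mu> \<Otimes>\<^sub>M \<nu>) \<mu> fst"
    unfolding \<gamma>_def by (subst distr_distr[OF fs(1) id]) (auto simp: comp_def sets intro!: distr_cong)
  moreover have "distr \<gamma> (restrict_space borel \<Omega>) snd = distr (\<mu> \<Otimes>\<^sub>M \<nu>) \<nu> snd"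
    unfolding \<gamma>_def by (subst distr_distr[OF fs(2) id]) (auto simp: comp_def sets intro!: distr_cong)
  moreover have "distr (\<mu> \<Otimes>\<^sub>M \<nu>) \<nu> snd = \<nu>"
  proof (rule measure_eqI)
    fix A assume "A \<in> sets (distr (\<mu> \<Otimes>\<^sub>M \<nu>) \<nu> snd)"
    then have A: "A \<in> sets \<nu>" by simp
    then have "snd -` A \<inter> space (\<mu> \<Otimes>\<^sub>M \<nu>) = space \<mu> \<times> A"
      using sets.sets_into_space by (auto simp: space_pair_measure)
    then show "emeasure (distr (\<mu> \<Otimes>\<^sub>M \<nu>) \<nu> snd) A = emeasure \<nu> A"
      using A by (simp add: emeasure_distr \<nu>.emeasure_pair_measure_Times \<mu>.emeasure_space_1)
  qed simp
  ultimately have "\<gamma> \<in> couplings \<Omega> \<mu> \<nu>"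
    using \<nu>.distr_pair_fst[of \<mu>] P.prob_space_distr[OF id]
    by (simp add: couplings_def borel_probs_def \<gamma>_def)
  then show ?thesis by blast
qed

lemma W2_squared:
  assumes "\<mu> \<in> borel_probs \<Omega>" "\<nu> \<in> borel_probs \<Omega>"
  shows "(W2 \<Omega> \<mu> \<nu>)\<^sup>2 = (INF \<gamma>\<in>couplings \<Omega> \<mu> \<nu>. \<integral>z. (norm (fst z - snd z))\<^sup>2 \<partial>\<gamma>)"
proof -
  have "0 \<le> (INF \<gamma>\<in>couplings \<Omega> \<mu> \<nu>. \<integral>z. (norm (fst z - snd z))\<^sup>2 \<partial>\<gamma>)"
    by (rule cINF_greatest[OF product_coupling[OF assms]]) simp
  then show ?thesis by (simp add: W2_def)
qed

lemma W2_squared_le: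
  assumes "\<mu> \<in> borel_probs \<Omega>" "\<nu> \<in> borel_probs \<Omega>" "\<gamma> \<in> couplings \<Omega> \<mu> \<nu>"
  shows "(W2 \<Omega> \<mu> \<nu>)\<^sup>2 \<le> (\<integral>z. (norm (fst z - snd z))\<^sup>2 \<partial>\<gamma>)"
  unfolding W2_squared[OF assms(1,2)]
  by (rule cINF_lower[OF _ assms(3)]) (auto intro!: bdd_belowI2[where m=0])

lemma transport_pair_laws:
  assumes "transport_pair \<Omega> \<mu> P X Y"
  shows "\<mu> \<in> borel_probs \<Omega>" "distr P (restrict_space borel \<Omega>) Y \<in> borel_probs \<Omega>"
  using assms borel_measurable_restrictI[of X P \<Omega>] borel_measurable_restrictI[of Y P \<Omega>]
  by (auto simp: transport_pair_def borel_probs_def intro!: prob_space.prob_space_distr)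

lemma transport_pair_coupling:
  fixes \<Omega> :: "'a::euclidean_space set"
  assumes "transport_pair \<Omega> \<mu> P X Y"
  defines "\<gamma> \<equiv> distr P (restrict_space borel (\<Omega> \<times> \<Omega>)) (\<lambda>\<omega>. (X \<omega>, Y \<omega>))"
  shows "\<gamma> \<in> couplings \<Omega> \<mu> (distr P (restrict_space borel \<Omega>) Y)"
    and "(\<integral>z. (norm (fst z - snd z))\<^sup>2 \<partial>\<gamma>) = (\<integral>\<omega>. (norm (X \<omega> - Y \<omega>))\<^sup>2 \<partial>P)"
proof -
  have P: "prob_space P" and [measurable]: "X \<in> borel_measurable P" "Y \<in> borel_measurable P"
    and in\<Omega>: "\<And>\<omega>. X \<omega> \<in> \<Omega>" "\<And>\<omega>. Y \<omega> \<in> \<Omega>" and \<mu>: "distr P (restrict_space borel \<Omega>) X = \<mu>"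
    using assms(1) by (auto simp: transport_pair_def)
  have XY: "(\<lambda>\<omega>. (X \<omega>, Y \<omega>)) \<in> measurable P (restrict_space borel (\<Omega> \<times> \<Omega>))"
    by (rule borel_measurable_restrictI) (use in\<Omega> in auto)
  have fs: "fst \<in> measurable (restrict_space borel (\<Omega> \<times> \<Omega>)) (restrict_space borel \<Omega>)"
    "snd \<in> measurable (restrict_space borel (\<Omega> \<times> \<Omega>)) (restrict_space borel \<Omega>)"
    by (rule measurable_projections_restrict)+
  show "\<gamma> \<in> couplings \<Omega> \<mu> (distr P (restrict_space borel \<Omega>) Y)"
    unfolding couplings_def borel_probs_def \<gamma>_def
    using prob_space.prob_space_distr[OF P XY] \<mu>
    by (simp add: distr_distr[OF fs(1) XY] distr_distr[OF fs(2) XY] comp_def)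
  show "(\<integral>z. (norm (fst z - snd z))\<^sup>2 \<partial>\<gamma>) = (\<integral>\<omega>. (norm (X \<omega> - Y \<omega>))\<^sup>2 \<partial>P)"
    unfolding \<gamma>_def
    by (subst integral_distr[OF XY])
      (auto intro!: measurable_restrict_space1 borel_measurable_continuous_onI continuous_intros)
qed

lemma continuous_potential:
  fixes V :: "real \<Rightarrow> real"
  assumes "continuous_on {0..} V"
  shows "continuous_on UNIV (\<lambda>x::'a::real_normed_vector. V ((norm x)\<^sup>2))"
  by (rule continuous_on_compose2[OF assms]) (auto intro!: continuous_intros)

text \<open>
  The interaction energy depends on the law of \<open>Y\<close> only and becomes an integral over two
  independent copies of the probability space.
\<close>
lemma functional_eq:
  fixes \<Omega> :: "'a::euclidean_space set"
  assumes pair: "transport_pair \<Omega> \<mu> P X Y" and V: "continuous_on {0..} V"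
  shows "functional_F \<Omega> V \<mu> (distr P (restrict_space borel \<Omega>) Y) =
    1 / 2 * (W2 \<Omega> \<mu> (distr P (restrict_space borel \<Omega>) Y))\<^sup>2 +
    (\<integral>z. V ((norm (Y (fst z) - Y (snd z)))\<^sup>2) \<partial>(P \<Otimes>\<^sub>M P))"
proof -
  define \<nu> where "\<nu> = distr P (restrict_space borel \<Omega>) Y"
  have P: "prob_space P" and [measurable]: "Y \<in> borel_measurable P" and in\<Omega>: "\<And>\<omega>. Y \<omega> \<in> \<Omega>"
    using pair by (auto simp: transport_pair_def)
  have Y: "Y \<in> measurable P (restrict_space borel \<Omega>)"
    by (rule borel_measurable_restrictI) (use in\<Omega> in auto)
  have id: "(\<lambda>x. x) \<in> measurable (restrict_space borel \<Omega>) borel"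
    by (rule measurable_restrict_space1) simp
  have fs: "fst \<in> borel_measurable (restrict_space borel \<Omega> \<Otimes>\<^sub>M restrict_space borel \<Omega>)"
     "snd \<in> borel_measurable (restrict_space borel \<Omega> \<Otimes>\<^sub>M restrict_space borel \<Omega>)"
    using measurable_compose[OF measurable_fst id] measurable_compose[OF measurable_snd id] by auto
  have m: "(\<lambda>x::'a. V ((norm x)\<^sup>2)) \<in> borel_measurable borel"
    by (rule borel_measurable_continuous_onI[OF continuous_potential[OF V]])
  have "(\<lambda>z. fst z - snd z) \<in> borel_measurable (restrict_space borel \<Omega> \<Otimes>\<^sub>M restrict_space borel \<Omega>)"
    by (rule borel_measurable_diff[OF fs])
  from measurable_compose[OF this m]
  have VV: "(\<lambda>z. V ((norm (fst z - snd z))\<^sup>2))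
      \<in> borel_measurable (restrict_space borel \<Omega> \<Otimes>\<^sub>M restrict_space borel \<Omega>)" .
  have "\<nu> \<Otimes>\<^sub>M \<nu> = distr (P \<Otimes>\<^sub>M P) (restrict_space borel \<Omega> \<Otimes>\<^sub>M restrict_space borel \<Omega>) (\<lambda>(x, y). (Y x, Y y))"
    unfolding \<nu>_def
    by (intro pair_measure_distr Y prob_space_imp_sigma_finite prob_space.prob_space_distr P)
  moreover have "(\<lambda>(x, y). (Y x, Y y)) \<in> measurable (P \<Otimes>\<^sub>M P) (restrict_space borel \<Omega> \<Otimes>\<^sub>M restrict_space borel \<Omega>)"
    using Y by measurable
  ultimately have "(\<integral>z. V ((norm (fst z - snd z))\<^sup>2) \<partial>(\<nu> \<Otimes>\<^sub>M \<nu>)) =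
      (\<integral>z. V ((norm (Y (fst z) - Y (snd z)))\<^sup>2) \<partial>(P \<Otimes>\<^sub>M P))"
    using VV by (simp add: integral_distr case_prod_beta)
  then show ?thesis by (simp add: functional_F_def \<nu>_def)
qed

lemma functional_le_plan_cost:
  assumes pair: "transport_pair \<Omega> \<mu> P X Y" and V: "continuous_on {0..} V"
  shows "functional_F \<Omega> V \<mu> (distr P (restrict_space borel \<Omega>) Y) \<le> plan_cost V P X Y"
  using W2_squared_le[OF transport_pair_laws[OF pair] transport_pair_coupling(1)[OF pair]]
  unfolding functional_eq[OF pair V] plan_cost_def transport_pair_coupling(2)[OF pair] by simp

text \<open>
  The form in which compactness is used: couplings with the fixed first marginal \<open>\<mu>\<close> become
  random pairs on one probability space, and the limit pair still has first marginal \<open>\<mu>\<close>.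
\<close>
lemma coupling_sequence_compact:
  fixes \<Omega> :: "'a::euclidean_space set"
  assumes \<Omega>: "compact \<Omega>" "convex \<Omega>"
    and \<gamma>: "\<And>n. \<gamma> n \<in> couplings \<Omega> \<mu> (\<nu> n)"
  obtains r :: "nat \<Rightarrow> nat" and P :: "real measure" and X Y X\<^sub>0 Y\<^sub>0
  where "strict_mono r" "\<And>n. transport_pair \<Omega> \<mu> P (X n) (Y n)" "transport_pair \<Omega> \<mu> P X\<^sub>0 Y\<^sub>0"
    "\<And>n. distr P (restrict_space borel \<Omega>) (Y n) = \<nu> (r n)"
    "\<And>n. (\<integral>z. (norm (fst z - snd z))\<^sup>2 \<partial>\<gamma> (r n)) = (\<integral>\<omega>. (norm (X n \<omega> - Y n \<omega>))\<^sup>2 \<partial>P)"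
    "\<And>\<omega>. \<omega> \<in> space P \<Longrightarrow> (\<lambda>n. X n \<omega>) \<longlonglongrightarrow> X\<^sub>0 \<omega>"
    "\<And>\<omega>. \<omega> \<in> space P \<Longrightarrow> (\<lambda>n. Y n \<omega>) \<longlonglongrightarrow> Y\<^sub>0 \<omega>"
proof -
  have prob: "prob_space (\<gamma> n)" and sets: "sets (\<gamma> n) = sets (restrict_space borel (\<Omega> \<times> \<Omega>))"
    and marg: "distr (\<gamma> n) (restrict_space borel \<Omega>) fst = \<mu>"
      "distr (\<gamma> n) (restrict_space borel \<Omega>) snd = \<nu> n" for n
    using \<gamma>[of n] by (auto simp: couplings_def borel_probs_def)
  have space: "space (\<gamma> n) = \<Omega> \<times> \<Omega>" for n
    using sets_eq_imp_space_eq[OF sets[of n]] by (simp add: space_restrict_space)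
  note id = measurable_id_restrict_borel[OF sets]
  have "\<Omega> \<noteq> {}" using prob_space.not_empty[OF prob[of 0]] space by auto
  have ae: "AE x in distr (\<gamma> n) borel (\<lambda>x. x). x \<in> \<Omega> \<times> \<Omega>" for n
    using \<Omega>(1) by (subst AE_distr_iff[OF id])
      (auto simp: space compact_imp_closed closed_Times borel_closed intro!: borel_closed)
  obtain r :: "nat \<Rightarrow> nat" and P :: "real measure" and Z :: "nat \<Rightarrow> real \<Rightarrow> 'a \<times> 'a" and Z\<^sub>0
    where r: "strict_mono r" and P: "prob_space P"
    and Z: "\<And>n. Z n \<in> borel_measurable P" and Z\<^sub>0: "Z\<^sub>0 \<in> borel_measurable P"
    and Zin: "\<And>n \<omega>. Z n \<omega> \<in> \<Omega> \<times> \<Omega>" and Z\<^sub>0in: "\<And>\<omega>. Z\<^sub>0 \<omega> \<in> \<Omega> \<times> \<Omega>"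
    and law: "\<And>n. distr P borel (Z n) = distr (\<gamma> (r n)) borel (\<lambda>x. x)"
    and lim: "\<And>\<omega>. \<omega> \<in> space P \<Longrightarrow> (\<lambda>n. Z n \<omega>) \<longlonglongrightarrow> Z\<^sub>0 \<omega>"
  proof (rule prob_sequence_compact[of "\<Omega> \<times> \<Omega>" "\<lambda>n. distr (\<gamma> n) borel (\<lambda>x. x)"])
    show "compact (\<Omega> \<times> \<Omega>)" "convex (\<Omega> \<times> \<Omega>)" "\<Omega> \<times> \<Omega> \<noteq> {}"
      using \<Omega> \<open>\<Omega> \<noteq> {}\<close> by (auto simp: compact_Times convex_Times)
    show "prob_space (distr (\<gamma> n) borel (\<lambda>x. x))" for n
      by (rule prob_space.prob_space_distr[OF prob id])
  qed (use ae in auto)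
  have law': "distr P (restrict_space borel (\<Omega> \<times> \<Omega>)) (Z n) = \<gamma> (r n)" for n
    by (rule distr_restrict_borel[OF sets Z Zin law])
  have Zr: "Z n \<in> measurable P (restrict_space borel (\<Omega> \<times> \<Omega>))" for n
    by (rule borel_measurable_restrictI[OF Z Zin])
  have fs: "fst \<in> measurable (restrict_space borel (\<Omega> \<times> \<Omega>)) (restrict_space borel \<Omega>)"
    "snd \<in> measurable (restrict_space borel (\<Omega> \<times> \<Omega>)) (restrict_space borel \<Omega>)"
    by (rule measurable_projections_restrict)+
  define X where "X n \<omega> = fst (Z n \<omega>)" for n \<omega>
  define Y where "Y n \<omega> = snd (Z n \<omega>)" for n \<omega>
  define X\<^sub>0 where "X\<^sub>0 \<omega> = fst (Z\<^sub>0 \<omega>)" for \<omega>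
  define Y\<^sub>0 where "Y\<^sub>0 \<omega> = snd (Z\<^sub>0 \<omega>)" for \<omega>
  have meas: "X n \<in> borel_measurable P" "Y n \<in> borel_measurable P"
     "X\<^sub>0 \<in> borel_measurable P" "Y\<^sub>0 \<in> borel_measurable P" for n
    using Z[of n] Z\<^sub>0 unfolding X_def Y_def X\<^sub>0_def Y\<^sub>0_def
    by (auto intro: measurable_compose[OF _ borel_measurable_projections(1)]
        measurable_compose[OF _ borel_measurable_projections(2)])
  have inn: "X n \<omega> \<in> \<Omega>" "Y n \<omega> \<in> \<Omega>" "X\<^sub>0 \<omega> \<in> \<Omega>" "Y\<^sub>0 \<omega> \<in> \<Omega>" for n \<omega>
    using Zin[of n \<omega>] Z\<^sub>0in[of \<omega>] by (auto simp: X_def Y_def X\<^sub>0_def Y\<^sub>0_def mem_Times_iff)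
  have lawX: "distr P (restrict_space borel \<Omega>) (X n) = \<mu>"
   and lawY: "distr P (restrict_space borel \<Omega>) (Y n) = \<nu> (r n)" for n
    using distr_distr[OF fs(1) Zr[of n]] distr_distr[OF fs(2) Zr[of n]] law'[of n] marg[of "r n"]
    by (simp_all add: X_def[abs_def] Y_def[abs_def] comp_def)
  have limX: "(\<lambda>n. X n \<omega>) \<longlonglongrightarrow> X\<^sub>0 \<omega>" and limY: "(\<lambda>n. Y n \<omega>) \<longlonglongrightarrow> Y\<^sub>0 \<omega>"
    if "\<omega> \<in> space P" for \<omega>
    using lim[OF that] by (auto simp: X_def Y_def X\<^sub>0_def Y\<^sub>0_def intro: tendsto_fst tendsto_snd)
  have "distr P borel X\<^sub>0 = distr \<mu> borel (\<lambda>x. x)"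
    by (rule law_of_pointwise_limit[OF P meas(1,3) limX])
      (simp_all add: distr_borel_restrict[OF meas(1) inn(1)] lawX)
  then have "distr P (restrict_space borel \<Omega>) X\<^sub>0 = \<mu>"
    by (intro distr_restrict_borel meas inn) (simp flip: lawX[of 0])
  then have pairs: "transport_pair \<Omega> \<mu> P (X n) (Y n)" "transport_pair \<Omega> \<mu> P X\<^sub>0 Y\<^sub>0" for n
    using P meas inn lawX by (auto simp: transport_pair_def)
  have cost: "(\<integral>z. (norm (fst z - snd z))\<^sup>2 \<partial>\<gamma> (r n)) = (\<integral>\<omega>. (norm (X n \<omega> - Y n \<omega>))\<^sup>2 \<partial>P)" for n
    using transport_pair_coupling(2)[OF pairs(1)[of n]] law'[of n] by (simp add: X_def Y_def)
  show thesis
    by (rule that[OF r pairs lawY cost limX limY])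
qed

section \<open>Existence of a minimizer\<close>

lemma integral_tendsto_of_bounded_continuous:
  fixes U :: "nat \<Rightarrow> 'c \<Rightarrow> 'b::metric_space" and g :: "'b \<Rightarrow> real"
  assumes Q: "prob_space Q" and g: "continuous_on UNIV g" and K: "compact K"
    and U[measurable]: "\<And>n. U n \<in> borel_measurable Q" "U\<^sub>0 \<in> borel_measurable Q"
    and UK: "\<And>n \<omega>. U n \<omega> \<in> K"
    and lim: "\<And>\<omega>. \<omega> \<in> space Q \<Longrightarrow> (\<lambda>n. U n \<omega>) \<longlonglongrightarrow> U\<^sub>0 \<omega>"
  shows "(\<lambda>n. \<integral>\<omega>. g (U n \<omega>) \<partial>Q) \<longlonglongrightarrow> (\<integral>\<omega>. g (U\<^sub>0 \<omega>) \<partial>Q)"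
proof -
  interpret prob_space Q by fact
  have [measurable]: "g \<in> borel_measurable borel" by (rule borel_measurable_continuous_onI[OF g])
  have "bounded (g ` K)"
    using compact_imp_bounded[OF compact_continuous_image[OF continuous_on_subset[OF g] K]] by simp
  then obtain B where "\<And>x. x \<in> K \<Longrightarrow> \<bar>g x\<bar> \<le> B" by (auto simp: bounded_iff)
  then show ?thesis
    using UK lim g
    by (intro integral_dominated_convergence[where w = "\<lambda>_. B"])
      (auto intro!: AE_I2 intro: isCont_tendsto_compose simp: continuous_on_eq_continuous_at)
qed

lemma
  fixes \<Omega> :: "'a::euclidean_space set"
  assumes \<Omega>: "compact \<Omega>"
    and pairs: "\<And>n. transport_pair \<Omega> \<mu> P (X n) (Y n)" "transport_pair \<Omega> \<mu> P X\<^sub>0 Y\<^sub>0"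
    and limX: "\<And>\<omega>. \<omega> \<in> space P \<Longrightarrow> (\<lambda>n. X n \<omega>) \<longlonglongrightarrow> X\<^sub>0 \<omega>"
    and limY: "\<And>\<omega>. \<omega> \<in> space P \<Longrightarrow> (\<lambda>n. Y n \<omega>) \<longlonglongrightarrow> Y\<^sub>0 \<omega>"
  shows transport_cost_tendsto:
      "(\<lambda>n. \<integral>\<omega>. (norm (X n \<omega> - Y n \<omega>))\<^sup>2 \<partial>P) \<longlonglongrightarrow> (\<integral>\<omega>. (norm (X\<^sub>0 \<omega> - Y\<^sub>0 \<omega>))\<^sup>2 \<partial>P)"
    and plan_cost_tendsto:
      "continuous_on {0..} V \<Longrightarrow> (\<lambda>n. plan_cost V P (X n) (Y n)) \<longlonglongrightarrow> plan_cost V P X\<^sub>0 Y\<^sub>0"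
proof -
  have P: "prob_space P"
    and [measurable]: "\<And>n. X n \<in> borel_measurable P" "\<And>n. Y n \<in> borel_measurable P"
       "X\<^sub>0 \<in> borel_measurable P" "Y\<^sub>0 \<in> borel_measurable P"
    and in\<Omega>: "\<And>n \<omega>. X n \<omega> \<in> \<Omega>" "\<And>n \<omega>. Y n \<omega> \<in> \<Omega>"
    using pairs by (auto simp: transport_pair_def)
  interpret prob_space P by fact
  interpret pair_prob_space P P by unfold_locales
  define K where "K = {x - y | x y. x \<in> \<Omega> \<and> y \<in> \<Omega>}"
  have K: "compact K" unfolding K_def by (rule compact_differences[OF \<Omega> \<Omega>])
  have inK: "x - y \<in> K" if "x \<in> \<Omega>" "y \<in> \<Omega>" for x y using that unfolding K_def by blast
  show cost: "(\<lambda>n. \<integral>\<omega>. (norm (X n \<omega> - Y n \<omega>))\<^sup>2 \<partial>P) \<longlonglongrightarrow> (\<integral>\<omega>. (norm (X\<^sub>0 \<omega> - Y\<^sub>0 \<omega>))\<^sup>2 \<partial>P)"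
    by (rule integral_tendsto_of_bounded_continuous[OF P _ K, of "\<lambda>x. (norm x)\<^sup>2"])
      (use in\<Omega> limX limY in \<open>auto intro!: inK continuous_intros tendsto_intros\<close>)
  assume V: "continuous_on {0..} V"
  have "(\<lambda>n. \<integral>z. V ((norm (Y n (fst z) - Y n (snd z)))\<^sup>2) \<partial>(P \<Otimes>\<^sub>M P))
    \<longlonglongrightarrow> (\<integral>z. V ((norm (Y\<^sub>0 (fst z) - Y\<^sub>0 (snd z)))\<^sup>2) \<partial>(P \<Otimes>\<^sub>M P))"
    by (rule integral_tendsto_of_bounded_continuous[OF P.prob_space_axioms continuous_potential[OF V] K])
      (use in\<Omega> limY in \<open>auto simp: space_pair_measure intro!: inK tendsto_intros\<close>)
  then show "(\<lambda>n. plan_cost V P (X n) (Y n)) \<longlonglongrightarrow> plan_cost V P X\<^sub>0 Y\<^sub>0"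
    unfolding plan_cost_def by (intro tendsto_intros cost)
qed

text \<open>
  Near-optimal couplings converge along a subsequence, both marginals are preserved, and the
  transport cost is continuous along the convergence.
\<close>
lemma W2_attained:
  fixes \<Omega> :: "'a::euclidean_space set"
  assumes \<Omega>: "compact \<Omega>" "convex \<Omega>" and \<mu>: "\<mu> \<in> borel_probs \<Omega>" and \<nu>: "\<nu> \<in> borel_probs \<Omega>"
  obtains \<gamma> where "\<gamma> \<in> couplings \<Omega> \<mu> \<nu>" "(W2 \<Omega> \<mu> \<nu>)\<^sup>2 = (\<integral>z. (norm (fst z - snd z))\<^sup>2 \<partial>\<gamma>)"
proof -
  let ?cost = "\<lambda>\<gamma>. \<integral>z. (norm (fst z - snd z :: 'a))\<^sup>2 \<partial>\<gamma>"
  have "\<exists>\<gamma>\<in>couplings \<Omega> \<mu> \<nu>. ?cost \<gamma> < (W2 \<Omega> \<mu> \<nu>)\<^sup>2 + inverse (real (Suc n))" for n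
    unfolding W2_squared[OF \<mu> \<nu>]
    by (intro cINF_less_iff[THEN iffD1] product_coupling[OF \<mu> \<nu>] bdd_belowI2[where m=0]) auto
  then obtain \<gamma> where \<gamma>: "\<And>n. \<gamma> n \<in> couplings \<Omega> \<mu> \<nu>"
    and small: "\<And>n. ?cost (\<gamma> n) < (W2 \<Omega> \<mu> \<nu>)\<^sup>2 + inverse (real (Suc n))"
    by metis
  obtain r :: "nat \<Rightarrow> nat" and P :: "real measure" and X Y X\<^sub>0 Y\<^sub>0 where r: "strict_mono r"
    and pairs: "\<And>n. transport_pair \<Omega> \<mu> P (X n) (Y n)" "transport_pair \<Omega> \<mu> P X\<^sub>0 Y\<^sub>0"
    and lawY: "\<And>n. distr P (restrict_space borel \<Omega>) (Y n) = \<nu>"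
    and cost: "\<And>n. ?cost (\<gamma> (r n)) = (\<integral>\<omega>. (norm (X n \<omega> - Y n \<omega>))\<^sup>2 \<partial>P)"
    and lim: "\<And>\<omega>. \<omega> \<in> space P \<Longrightarrow> (\<lambda>n. X n \<omega>) \<longlonglongrightarrow> X\<^sub>0 \<omega>"
      "\<And>\<omega>. \<omega> \<in> space P \<Longrightarrow> (\<lambda>n. Y n \<omega>) \<longlonglongrightarrow> Y\<^sub>0 \<omega>"
    by (rule coupling_sequence_compact[OF \<Omega>, of \<gamma> \<mu> "\<lambda>_. \<nu>"]) (rule \<gamma>, rule that)
  have P: "prob_space P" and Y: "\<And>n. Y n \<in> borel_measurable P" "Y\<^sub>0 \<in> borel_measurable P"
    "\<And>n \<omega>. Y n \<omega> \<in> \<Omega>" "\<And>\<omega>. Y\<^sub>0 \<omega> \<in> \<Omega>"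
    using pairs by (auto simp: transport_pair_def)
  have "distr P borel Y\<^sub>0 = distr \<nu> borel (\<lambda>x. x)"
    by (rule law_of_pointwise_limit[OF P Y(1,2) lim(2)])
      (simp_all add: distr_borel_restrict[OF Y(1,3)] lawY)
  then have lawY\<^sub>0: "distr P (restrict_space borel \<Omega>) Y\<^sub>0 = \<nu>"
    by (intro distr_restrict_borel Y) (simp flip: lawY[of 0])
  define \<gamma>\<^sub>0 where "\<gamma>\<^sub>0 = distr P (restrict_space borel (\<Omega> \<times> \<Omega>)) (\<lambda>\<omega>. (X\<^sub>0 \<omega>, Y\<^sub>0 \<omega>))"
  have \<gamma>\<^sub>0: "\<gamma>\<^sub>0 \<in> couplings \<Omega> \<mu> \<nu>" "?cost \<gamma>\<^sub>0 = (\<integral>\<omega>. (norm (X\<^sub>0 \<omega> - Y\<^sub>0 \<omega>))\<^sup>2 \<partial>P)"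
    using transport_pair_coupling[OF pairs(2)] by (simp_all add: \<gamma>\<^sub>0_def lawY\<^sub>0)
  have "?cost \<gamma>\<^sub>0 \<le> (W2 \<Omega> \<mu> \<nu>)\<^sup>2 + 0"
  proof (rule LIMSEQ_le)
    show "(\<lambda>n. ?cost (\<gamma> (r n))) \<longlonglongrightarrow> ?cost \<gamma>\<^sub>0"
      unfolding cost \<gamma>\<^sub>0(2) by (rule transport_cost_tendsto[OF \<Omega>(1) pairs lim])
    have "(\<lambda>n. inverse (real (Suc (r n)))) \<longlonglongrightarrow> 0"
      using LIMSEQ_subseq_LIMSEQ[OF LIMSEQ_inverse_real_of_nat r] by (simp add: comp_def)
    then show "(\<lambda>n. (W2 \<Omega> \<mu> \<nu>)\<^sup>2 + inverse (real (Suc (r n)))) \<longlonglongrightarrow> (W2 \<Omega> \<mu> \<nu>)\<^sup>2 + 0"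
      by (intro tendsto_intros)
    show "\<exists>N. \<forall>n\<ge>N. ?cost (\<gamma> (r n)) \<le> (W2 \<Omega> \<mu> \<nu>)\<^sup>2 + inverse (real (Suc (r n)))"
      using small less_imp_le by blast
  qed
  with W2_squared_le[OF \<mu> \<nu> \<gamma>\<^sub>0(1)] have "(W2 \<Omega> \<mu> \<nu>)\<^sup>2 = ?cost \<gamma>\<^sub>0" by simp
  with \<gamma>\<^sub>0(1) show thesis by (rule that)
qed

text \<open>
  Turns an optimal coupling into a random pair. The constant sequence in
  \<open>coupling_sequence_compact\<close> serves as the representation theorem for a single coupling.
\<close>
lemma functional_attained:
  fixes \<Omega> :: "'a::euclidean_space set"
  assumes \<Omega>: "compact \<Omega>" "convex \<Omega>" and \<mu>: "\<mu> \<in> borel_probs \<Omega>" and \<nu>: "\<nu> \<in> borel_probs \<Omega>"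
    and V: "continuous_on {0..} V"
  obtains P :: "real measure" and X Y where "transport_pair \<Omega> \<mu> P X Y"
    "distr P (restrict_space borel \<Omega>) Y = \<nu>" "functional_F \<Omega> V \<mu> \<nu> = plan_cost V P X Y"
proof -
  obtain \<gamma> where \<gamma>: "\<gamma> \<in> couplings \<Omega> \<mu> \<nu>" "(W2 \<Omega> \<mu> \<nu>)\<^sup>2 = (\<integral>z. (norm (fst z - snd z))\<^sup>2 \<partial>\<gamma>)"
    using W2_attained[OF \<Omega> \<mu> \<nu>] by blast
  obtain r :: "nat \<Rightarrow> nat" and P :: "real measure" and X Y X\<^sub>0 Y\<^sub>0 where "strict_mono r"
    and pair: "\<And>n. transport_pair \<Omega> \<mu> P (X n) (Y n)" and "transport_pair \<Omega> \<mu> P X\<^sub>0 Y\<^sub>0"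
    and lawY: "\<And>n. distr P (restrict_space borel \<Omega>) (Y n) = \<nu>"
    and cost: "\<And>n. (\<integral>z. (norm (fst z - snd z))\<^sup>2 \<partial>\<gamma>) = (\<integral>\<omega>. (norm (X n \<omega> - Y n \<omega>))\<^sup>2 \<partial>P)"
    and "\<And>\<omega>. \<omega> \<in> space P \<Longrightarrow> (\<lambda>n. X n \<omega>) \<longlonglongrightarrow> X\<^sub>0 \<omega>"
      "\<And>\<omega>. \<omega> \<in> space P \<Longrightarrow> (\<lambda>n. Y n \<omega>) \<longlonglongrightarrow> Y\<^sub>0 \<omega>"
    by (rule coupling_sequence_compact[OF \<Omega>, of "\<lambda>_. \<gamma>" \<mu> "\<lambda>_. \<nu>"]) (rule \<gamma>(1), rule that)
  show thesis
    using that[OF pair lawY] functional_eq[OF pair V, of 0] lawY cost \<gamma>(2)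
    by (simp add: plan_cost_def)
qed

text \<open>
  Take optimal couplings along a minimizing sequence of measures. Their limit pair bounds the functional
  at the limit law from above by the infimum, whether or not the limit coupling is optimal.
\<close>
lemma minimizer_exists:
  fixes \<Omega> :: "'a::euclidean_space set"
  assumes \<Omega>: "compact \<Omega>" "convex \<Omega>" and \<mu>: "\<mu> \<in> borel_probs \<Omega>"
    and V: "continuous_on {0..} V" and V_nonneg: "\<And>t. t \<ge> 0 \<Longrightarrow> V t \<ge> 0"
  shows "\<exists>\<nu>. is_arg_min (functional_F \<Omega> V \<mu>) (\<lambda>\<nu>. \<nu> \<in> borel_probs \<Omega>) \<nu>"
proof -
  let ?F = "functional_F \<Omega> V \<mu>"
  define m where "m = (INF \<nu>\<in>borel_probs \<Omega>. ?F \<nu>)"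
  have F_nonneg: "0 \<le> ?F \<nu>" for \<nu>
    unfolding functional_F_def by (intro add_nonneg_nonneg Bochner_Integration.integral_nonneg V_nonneg) simp_all
  then have bdd: "bdd_below (?F ` borel_probs \<Omega>)" by (intro bdd_belowI2[where m=0])
  have "\<exists>\<nu>\<in>borel_probs \<Omega>. ?F \<nu> < m + inverse (real (Suc n))" for n
    unfolding m_def using \<mu> by (intro cINF_less_iff[THEN iffD1] bdd) auto
  then obtain \<nu> where \<nu>: "\<And>n. \<nu> n \<in> borel_probs \<Omega>"
    and small: "\<And>n. ?F (\<nu> n) < m + inverse (real (Suc n))" by metis
  have "\<exists>\<gamma>. \<gamma> \<in> couplings \<Omega> \<mu> (\<nu> n) \<and> (W2 \<Omega> \<mu> (\<nu> n))\<^sup>2 = (\<integral>z. (norm (fst z - snd z))\<^sup>2 \<partial>\<gamma>)" for n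
    using W2_attained[OF \<Omega> \<mu> \<nu>] by metis
  then obtain \<gamma> where \<gamma>: "\<And>n. \<gamma> n \<in> couplings \<Omega> \<mu> (\<nu> n)"
    and opt: "\<And>n. (W2 \<Omega> \<mu> (\<nu> n))\<^sup>2 = (\<integral>z. (norm (fst z - snd z))\<^sup>2 \<partial>(\<gamma> n))"
    by metis
  obtain r :: "nat \<Rightarrow> nat" and P :: "real measure" and X Y X\<^sub>0 Y\<^sub>0 where r: "strict_mono r"
    and pairs: "\<And>n. transport_pair \<Omega> \<mu> P (X n) (Y n)" "transport_pair \<Omega> \<mu> P X\<^sub>0 Y\<^sub>0"
    and lawY: "\<And>n. distr P (restrict_space borel \<Omega>) (Y n) = \<nu> (r n)"
    and cost: "\<And>n. (\<integral>z. (norm (fst z - snd z))\<^sup>2 \<partial>(\<gamma> (r n))) = (\<integral>\<omega>. (norm (X n \<omega> - Y n \<omega>))\<^sup>2 \<partial>P)"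
    and lim: "\<And>\<omega>. \<omega> \<in> space P \<Longrightarrow> (\<lambda>n. X n \<omega>) \<longlonglongrightarrow> X\<^sub>0 \<omega>"
      "\<And>\<omega>. \<omega> \<in> space P \<Longrightarrow> (\<lambda>n. Y n \<omega>) \<longlonglongrightarrow> Y\<^sub>0 \<omega>"
    by (rule coupling_sequence_compact[OF \<Omega>, of \<gamma> \<mu> \<nu>]) (rule \<gamma>, rule that)
  have F_eq: "?F (\<nu> (r n)) = plan_cost V P (X n) (Y n)" for n
    using functional_eq[OF pairs(1) V, of n] by (simp add: lawY opt cost plan_cost_def)
  define \<nu>\<^sub>0 where "\<nu>\<^sub>0 = distr P (restrict_space borel \<Omega>) Y\<^sub>0"
  have \<nu>\<^sub>0: "\<nu>\<^sub>0 \<in> borel_probs \<Omega>"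
    unfolding \<nu>\<^sub>0_def by (rule transport_pair_laws(2)[OF pairs(2)])
  have "plan_cost V P X\<^sub>0 Y\<^sub>0 \<le> m + 0"
  proof (rule LIMSEQ_le)
    show "(\<lambda>n. ?F (\<nu> (r n))) \<longlonglongrightarrow> plan_cost V P X\<^sub>0 Y\<^sub>0"
      unfolding F_eq by (rule plan_cost_tendsto[OF \<Omega>(1) pairs lim V])
    have "(\<lambda>n. inverse (real (Suc (r n)))) \<longlonglongrightarrow> 0"
      using LIMSEQ_subseq_LIMSEQ[OF LIMSEQ_inverse_real_of_nat r] by (simp add: comp_def)
    then show "(\<lambda>n. m + inverse (real (Suc (r n)))) \<longlonglongrightarrow> m + 0"
      by (intro tendsto_intros)
    show "\<exists>N. \<forall>n\<ge>N. ?F (\<nu> (r n)) \<le> m + inverse (real (Suc (r n)))"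
      using small less_imp_le by blast
  qed
  then have "?F \<nu>\<^sub>0 \<le> m"
    using functional_le_plan_cost[OF pairs(2) V] by (simp add: \<nu>\<^sub>0_def)
  moreover have "m \<le> ?F \<nu>'" if "\<nu>' \<in> borel_probs \<Omega>" for \<nu>'
    unfolding m_def by (rule cINF_lower[OF bdd that])
  ultimately have "is_arg_min ?F (\<lambda>\<nu>. \<nu> \<in> borel_probs \<Omega>) \<nu>\<^sub>0"
    using \<nu>\<^sub>0 unfolding is_arg_min_def by (meson leD order_trans)
  then show ?thesis by blast
qed

section \<open>Quadratic bounds and averages\<close>

text \<open>
  The quantitative content of \<open>V\<close> being \<open>C\<^sup>2\<close> on \<open>[0, R]\<close>: a bound and a Lipschitz bound for \<open>V'\<close> make
  \<open>optimal_source\<close> Lipschitz, and the one-sided Taylor bound controls the energy of a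
  competitor to second order.
\<close>
lemma C2_potential_bounds:
  fixes V V' V'' :: "real \<Rightarrow> real"
  assumes V: "\<And>t. t \<ge> 0 \<Longrightarrow> (V has_real_derivative V' t) (at t within {0..})"
    and V': "\<And>t. t \<ge> 0 \<Longrightarrow> (V' has_real_derivative V'' t) (at t within {0..})"
    and V'': "continuous_on {0..} V''" and R: "0 \<le> R"
  obtains B M where "0 \<le> M" "\<And>s. s \<in> {0..R} \<Longrightarrow> V' s \<le> B"
    "\<And>s u. s \<in> {0..R} \<Longrightarrow> u \<in> {0..R} \<Longrightarrow> \<bar>V' s - V' u\<bar> \<le> M * \<bar>s - u\<bar>"
    "\<And>s u. s \<in> {0..R} \<Longrightarrow> u \<in> {0..R} \<Longrightarrow> V u \<le> V s + V' s * (u - s) + M * (u - s)\<^sup>2"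
proof -
  have contV': "continuous_on {0..} V'"
    using V' by (auto intro!: DERIV_continuous_on)
  have "bounded (V' ` {0..R})" "bounded (V'' ` {0..R})"
    using continuous_on_subset[OF contV', of "{0..R}"] continuous_on_subset[OF V'', of "{0..R}"]
    by (auto intro!: compact_imp_bounded compact_continuous_image)
  then obtain B M where B: "\<And>s. s \<in> {0..R} \<Longrightarrow> \<bar>V' s\<bar> \<le> B" and M: "\<And>s. s \<in> {0..R} \<Longrightarrow> \<bar>V'' s\<bar> \<le> M"
    unfolding bounded_iff by fastforce
  have M0: "0 \<le> M" using M[of 0] R by force
  have lip: "\<bar>V' s - V' u\<bar> \<le> M * \<bar>s - u\<bar>" if "s \<in> {0..R}" "u \<in> {0..R}" for s u
  proof -
    have "norm (V' s - V' u) \<le> M * norm (s - u)"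
    proof (rule field_differentiable_bound[of "{0..R}"])
      show "(V' has_field_derivative V'' x) (at x within {0..R})" if "x \<in> {0..R}" for x
        using that by (intro DERIV_subset[OF V']) auto
    qed (use M that in auto)
    then show ?thesis by simp
  qed
  have taylor: "V u \<le> V s + V' s * (u - s) + M * (u - s)\<^sup>2" if s: "s \<in> {0..R}" and u: "u \<in> {0..R}" for s u
  proof -
    have seg: "x \<in> {0..R} \<and> \<bar>x - s\<bar> \<le> \<bar>u - s\<bar>" if "x \<in> closed_segment s u" for x
      using that s u by (auto simp: closed_segment_eq_real_ivl split: if_splits)
    have "norm ((V u - V' s * u) - (V s - V' s * s)) \<le> (M * \<bar>u - s\<bar>) * norm (u - s)"
    proof (rule field_differentiable_bound[of "closed_segment s u"])
      fix x assume x: "x \<in> closed_segment s u"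
      show "((\<lambda>x. V x - V' s * x) has_field_derivative V' x - V' s) (at x within closed_segment s u)"
        using seg x by (auto intro!: derivative_eq_intros DERIV_subset[OF V])
      have "\<bar>V' x - V' s\<bar> \<le> M * \<bar>x - s\<bar>" using lip seg[OF x] s by blast
      also have "\<dots> \<le> M * \<bar>u - s\<bar>" using seg[OF x] M0 by (simp add: mult_left_mono)
      finally show "norm (V' x - V' s) \<le> M * \<bar>u - s\<bar>" by simp
    qed auto
    then have "\<bar>(V u - V' s * u) - (V s - V' s * s)\<bar> \<le> M * (u - s)\<^sup>2"
      by (simp add: power2_eq_square mult.assoc)
    then have "(V u - V' s * u) - (V s - V' s * s) \<le> M * (u - s)\<^sup>2" by linarith
    then show ?thesis by (simp add: algebra_simps)
  qed
  show thesis
    by (rule that[OF M0 _ lip taylor]) (use B in \<open>auto dest: abs_le_D1\<close>)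
qed

text \<open>
  A point outside would be strictly separated by a hyperplane, contradicting monotonicity of the
  integral.
\<close>
lemma expectation_in_closed_convex:
  fixes f :: "'c \<Rightarrow> 'a::euclidean_space"
  assumes P: "prob_space P" and S: "closed S" "convex S" and f: "integrable P f" "\<And>\<omega>. f \<omega> \<in> S"
  shows "integral\<^sup>L P f \<in> S"
proof (rule ccontr)
  interpret prob_space P by fact
  assume "integral\<^sup>L P f \<notin> S"
  then obtain a b where ab: "a \<bullet> integral\<^sup>L P f < b" "\<And>x. x \<in> S \<Longrightarrow> b < a \<bullet> x"
    using separating_hyperplane_closed_point[OF S(2,1)] by blast
  have "b = (\<integral>\<omega>. b \<partial>P)" by (simp add: prob_space)
  also have "\<dots> \<le> (\<integral>\<omega>. a \<bullet> f \<omega> \<partial>P)"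
    by (rule integral_mono) (use f ab(2) less_imp_le in auto)
  also have "\<dots> = a \<bullet> integral\<^sup>L P f" using f(1) by simp
  finally show False using ab(1) by simp
qed

lemma convexD_three:
  assumes "convex S" "x \<in> S" "y \<in> S" "z \<in> S" "0 \<le> a" "0 \<le> b" "0 \<le> c" "a + b + c = 1"
  shows "a *\<^sub>R x + b *\<^sub>R y + c *\<^sub>R z \<in> S"
proof -
  have "a *\<^sub>R x + b *\<^sub>R y + c *\<^sub>R z \<in> convex hull {x, y, z}"
    using assms(5-) unfolding convex_hull_3 by blast
  then show ?thesis using hull_minimal[of "{x, y, z}" S convex] assms(1-4) by auto
qed


section \<open>One descent step from an optimal pair\<close>

text \<open>
  If an interior point \<open>y\<close> of \<open>\<Omega>\<close> minimizes \<open>|x - y|\<^sup>2 / 2 + 2 * \<Phi> y\<close>, where \<open>\<Phi> y\<close> is the expectation of \<open>V(|y - Y|\<^sup>2)\<close>, then the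
  first-order condition \<open>x = y + 2 * \<nabla>\<Phi> y\<close> determines the point \<open>x\<close> from which \<open>y\<close> receives its mass.
  One factor 2 comes from both particles feeling the interaction, the other from the
  derivative of the squared norm.
\<close>
definition optimal_source :: "(real \<Rightarrow> real) \<Rightarrow> 'c measure \<Rightarrow> ('c \<Rightarrow> 'a::euclidean_space) \<Rightarrow> 'a \<Rightarrow> 'a"
  where "optimal_source V' P Y y =
    y + 4 *\<^sub>R (\<integral>\<omega>. V' ((norm (y - Y \<omega>))\<^sup>2) *\<^sub>R (y - Y \<omega>) \<partial>P)"

text \<open>
  A pair together with the constants of \<open>C2_potential_bounds\<close> on the range \<open>[0, D\<^sup>2]\<close> of squared
  distances in \<open>\<Omega>\<close>.
\<close>
locale interacting_pair =
  fixes \<Omega> :: "'a::euclidean_space set" and \<mu> :: "'a measure" and P :: "'c measure"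
    and X Y :: "'c \<Rightarrow> 'a" and V V' :: "real \<Rightarrow> real" and D B M :: real
  assumes pair: "transport_pair \<Omega> \<mu> P X Y"
    and compact: "compact \<Omega>" and convex: "convex \<Omega>"
    and diam: "\<And>x y. x \<in> \<Omega> \<Longrightarrow> y \<in> \<Omega> \<Longrightarrow> norm (x - y) \<le> D"
    and contV: "continuous_on {0..} V" and contV': "continuous_on {0..} V'"
    and M_nonneg: "0 \<le> M"
    and V'_nonneg: "\<And>s. s \<ge> 0 \<Longrightarrow> 0 \<le> V' s"
    and V'_le: "\<And>s. s \<in> {0..D\<^sup>2} \<Longrightarrow> V' s \<le> B"
    and V'_lipschitz: "\<And>s u. s \<in> {0..D\<^sup>2} \<Longrightarrow> u \<in> {0..D\<^sup>2} \<Longrightarrow> \<bar>V' s - V' u\<bar> \<le> M * \<bar>s - u\<bar>"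
    and V_taylor: "\<And>s u. s \<in> {0..D\<^sup>2} \<Longrightarrow> u \<in> {0..D\<^sup>2} \<Longrightarrow>
      V u \<le> V s + V' s * (u - s) + M * (u - s)\<^sup>2"
begin

sublocale prob_space P
  using pair by (simp add: transport_pair_def)

sublocale PP: pair_prob_space P P ..

abbreviation source :: "'a \<Rightarrow> 'a" where "source \<equiv> optimal_source V' P Y"

abbreviation force :: "'a \<Rightarrow> 'a" where "force w \<equiv> V' ((norm w)\<^sup>2) *\<^sub>R w"

lemma X_measurable[measurable]: "X \<in> borel_measurable P"
  and Y_measurable[measurable]: "Y \<in> borel_measurable P"
  and X_in: "X \<omega> \<in> \<Omega>" and Y_in: "Y \<omega> \<in> \<Omega>"
  using pair by (auto simp: transport_pair_def)

lemma V_measurable[measurable]: "(\<lambda>w::'a. V ((norm w)\<^sup>2)) \<in> borel_measurable borel"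
  and V'_measurable[measurable]: "(\<lambda>w::'a. V' ((norm w)\<^sup>2)) \<in> borel_measurable borel"
  using continuous_potential[OF contV] continuous_potential[OF contV']
  by (auto intro: borel_measurable_continuous_onI)

lemma D_nonneg: "0 \<le> D"
  by (rule order_trans[OF norm_ge_zero diam[OF X_in X_in]])

lemma B_nonneg: "0 \<le> B"
  using V'_nonneg[of 0] V'_le[of 0] by simp

lemma sq_in: "x \<in> \<Omega> \<Longrightarrow> y \<in> \<Omega> \<Longrightarrow> (norm (x - y))\<^sup>2 \<in> {0..D\<^sup>2}"
  using diam[of x y] by (auto intro: power_mono)

lemma force_bound:
  assumes "x \<in> \<Omega>" "y \<in> \<Omega>"
  shows "norm (force (x - y)) \<le> B * D"
  using diam[OF assms] V'_le[OF sq_in[OF assms]] V'_nonneg[of "(norm (x - y))\<^sup>2"] B_nonneg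
  by (auto intro!: mult_mono)

lemma force_integrable:
  assumes "y \<in> \<Omega>"
  shows "integrable P (\<lambda>\<omega>. force (y - Y \<omega>))"
proof (rule integrable_const_bound[where B = "B * D"])
  show "AE \<omega> in P. norm (force (y - Y \<omega>)) \<le> B * D"
    using force_bound[OF assms Y_in] by auto
  have "(\<lambda>w. force w) \<in> borel_measurable borel" by measurable
  then show "(\<lambda>\<omega>. force (y - Y \<omega>)) \<in> borel_measurable P"
    by (rule measurable_compose[rotated]) measurable
qed

lemma source_measurable[measurable]: "(\<lambda>\<omega>. source (Y \<omega>)) \<in> borel_measurable P"
proof -
  have "(\<lambda>w. force w) \<in> borel_measurable borel" by measurable
  then have [measurable]: "(\<lambda>z. force (Y (fst z) - Y (snd z))) \<in> borel_measurable (P \<Otimes>\<^sub>M P)"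
    by (rule measurable_compose[rotated]) measurable
  have "(\<lambda>\<omega>. \<integral>\<omega>'. force (Y \<omega> - Y \<omega>') \<partial>P) \<in> borel_measurable P"
    by (rule borel_measurable_lebesgue_integral) (simp add: case_prod_beta)
  then show ?thesis unfolding optimal_source_def by measurable
qed

text \<open>
  The force \<open>w \<mapsto> V'(|w|\<^sup>2) w\<close> is Lipschitz on the ball of radius \<open>D\<close>, and averaging preserves the constant.
\<close>
lemma source_lipschitz:
  assumes y: "y \<in> \<Omega>" and z: "z \<in> \<Omega>"
  shows "norm (source y - source z) \<le> (1 + 4 * (B + 2 * M * D\<^sup>2)) * norm (y - z)"
proof -
  have "norm (force (y - Y \<omega>) - force (z - Y \<omega>)) \<le> (B + 2 * M * D\<^sup>2) * norm (y - z)" for \<omega>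
  proof -
    define v where "v = y - Y \<omega>"
    define w where "w = z - Y \<omega>"
    have vw: "v - w = y - z" by (simp add: v_def w_def)
    have bounds: "norm v \<le> D" "norm w \<le> D"
      using diam y z Y_in by (auto simp: v_def w_def)
    have "\<bar>(norm v)\<^sup>2 - (norm w)\<^sup>2\<bar> = \<bar>norm v - norm w\<bar> * (norm v + norm w)"
      by (simp add: power2_eq_square square_diff_square_factored abs_mult mult.commute)
    also have "\<dots> \<le> norm (y - z) * (2 * D)"
      using bounds norm_triangle_ineq3[of v w] by (intro mult_mono) (auto simp: vw)
    finally have sq: "\<bar>(norm v)\<^sup>2 - (norm w)\<^sup>2\<bar> \<le> norm (y - z) * (2 * D)" .
    have "force v - force w = V' ((norm v)\<^sup>2) *\<^sub>R (v - w) + (V' ((norm v)\<^sup>2) - V' ((norm w)\<^sup>2)) *\<^sub>R w"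
      by (simp add: algebra_simps)
    then have "norm (force v - force w) \<le>
        \<bar>V' ((norm v)\<^sup>2)\<bar> * norm (v - w) + \<bar>V' ((norm v)\<^sup>2) - V' ((norm w)\<^sup>2)\<bar> * norm w"
      by (metis norm_scaleR norm_triangle_ineq)
    also have "\<dots> \<le> B * norm (y - z) + (M * (norm (y - z) * (2 * D))) * D"
    proof (intro add_mono mult_mono)
      show "\<bar>V' ((norm v)\<^sup>2)\<bar> \<le> B"
        using V'_nonneg[of "(norm v)\<^sup>2"] V'_le[OF sq_in[OF y Y_in]] by (simp add: v_def)
      have "\<bar>V' ((norm v)\<^sup>2) - V' ((norm w)\<^sup>2)\<bar> \<le> M * \<bar>(norm v)\<^sup>2 - (norm w)\<^sup>2\<bar>"
        unfolding v_def w_def using y z Y_in by (intro V'_lipschitz sq_in) 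
      also have "\<dots> \<le> M * (norm (y - z) * (2 * D))" using sq M_nonneg by (rule mult_left_mono)
      finally show "\<bar>V' ((norm v)\<^sup>2) - V' ((norm w)\<^sup>2)\<bar> \<le> M * (norm (y - z) * (2 * D))" .
    qed (use bounds B_nonneg M_nonneg D_nonneg vw in auto)
    also have "\<dots> = (B + 2 * M * D\<^sup>2) * norm (y - z)"
      by (simp add: algebra_simps power2_eq_square)
    finally show ?thesis by (simp add: v_def w_def)
  qed
  then have "norm (\<integral>\<omega>. force (y - Y \<omega>) - force (z - Y \<omega>) \<partial>P) \<le> (B + 2 * M * D\<^sup>2) * norm (y - z)"
    using force_integrable[OF y] force_integrable[OF z] B_nonneg M_nonneg
    by (intro order_trans[OF integral_norm_bound]) (auto intro!: integral_le_const)
  then have "norm ((y - z) + 4 *\<^sub>R (\<integral>\<omega>. force (y - Y \<omega>) - force (z - Y \<omega>) \<partial>P))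
      \<le> norm (y - z) + 4 * ((B + 2 * M * D\<^sup>2) * norm (y - z))"
    by (intro order_trans[OF norm_triangle_ineq] add_mono) auto
  also have "(y - z) + 4 *\<^sub>R (\<integral>\<omega>. force (y - Y \<omega>) - force (z - Y \<omega>) \<partial>P) = source y - source z"
    unfolding optimal_source_def
      Bochner_Integration.integral_diff[OF force_integrable[OF y] force_integrable[OF z]]
    by (simp add: scaleR_diff_right)
  finally show ?thesis by (simp add: algebra_simps)
qed

text \<open>
  The step is the average over \<open>\<omega>\<close> of \<open>(1 - t - a) y + t x + a Y(\<omega>)\<close> with
  \<open>a = 4 t V'(|y - Y(\<omega>)|\<^sup>2)\<close>. The weights are nonnegative because \<open>V' \<ge> 0\<close> and \<open>t\<close> is small, so every
  term is a convex combination of points of \<open>\<Omega>\<close>. This is where attraction keeps the competitor inside,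
  even when \<open>y\<close> is a boundary point.
\<close>
lemma descent_step_in:
  assumes x: "x \<in> \<Omega>" and y: "y \<in> \<Omega>" and t: "0 \<le> t" "t * (1 + 4 * B) \<le> 1"
  shows "y + t *\<^sub>R (x - source y) \<in> \<Omega>"
proof -
  have "y + t *\<^sub>R (x - source y) = (\<integral>\<omega>. y + t *\<^sub>R (x - y) - (4 * t) *\<^sub>R force (y - Y \<omega>) \<partial>P)"
  proof -
    have affine: "(\<integral>\<omega>. c - k *\<^sub>R f \<omega> \<partial>P) = c - k *\<^sub>R (\<integral>\<omega>. f \<omega> \<partial>P)"
      if "integrable P f" for c k and f :: "'c \<Rightarrow> 'a"
      using that by (simp add: prob_space)
    show ?thesis
      unfolding optimal_source_def affine[OF force_integrable[OF y]]
      by (simp add: scaleR_diff_right scaleR_add_right)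
  qed
  also have "\<dots> \<in> \<Omega>"
  proof (rule expectation_in_closed_convex[OF prob_space_axioms compact_imp_closed[OF compact] convex])
    show "integrable P (\<lambda>\<omega>. y + t *\<^sub>R (x - y) - (4 * t) *\<^sub>R force (y - Y \<omega>))"
      by (intro Bochner_Integration.integrable_diff integrable_scaleR_right force_integrable[OF y]) simp
    fix \<omega>
    define a where "a = 4 * t * V' ((norm (y - Y \<omega>))\<^sup>2)"
    have a: "0 \<le> a" "a \<le> 4 * t * B"
      using V'_nonneg[of "(norm (y - Y \<omega>))\<^sup>2"] V'_le[OF sq_in[OF y Y_in]] t
      by (auto simp: a_def intro: mult_left_mono)
    have sum1: "t + a \<le> 1" using a t by (simp add: algebra_simps)
    have "y + t *\<^sub>R (x - y) - (4 * t) *\<^sub>R force (y - Y \<omega>) = (1 - (t + a)) *\<^sub>R y + t *\<^sub>R x + a *\<^sub>R Y \<omega>"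
      by (simp add: a_def algebra_simps)
    also have "\<dots> \<in> \<Omega>"
      using convex y x Y_in[of \<omega>] sum1 t a by (intro convexD_three) auto
    finally show "y + t *\<^sub>R (x - y) - (4 * t) *\<^sub>R force (y - Y \<omega>) \<in> \<Omega>" .
  qed
  finally show ?thesis .
qed

text \<open>
  The failure of the first-order condition, which is also the negative gradient of \<open>plan_cost\<close> in
  the variable \<open>Y\<close>.
\<close>
definition residual :: "'c \<Rightarrow> 'a" where "residual \<omega> = X \<omega> - source (Y \<omega>)"

lemma residual_measurable[measurable]: "residual \<in> borel_measurable P"
  unfolding residual_def[abs_def] by measurable

lemma residual_bound: "norm (residual \<omega>) \<le> D + 4 * (B * D)"
proof -
  have "norm (\<integral>\<omega>'. force (Y \<omega> - Y \<omega>') \<partial>P) \<le> B * D"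
    using force_integrable[OF Y_in] force_bound[OF Y_in Y_in]
    by (intro order_trans[OF integral_norm_bound]) (auto intro!: integral_le_const simp del: norm_scaleR)
  moreover have "norm (residual \<omega>) \<le> norm (X \<omega> - Y \<omega>) + norm (4 *\<^sub>R (\<integral>\<omega>'. force (Y \<omega> - Y \<omega>') \<partial>P))"
    unfolding residual_def optimal_source_def diff_diff_eq[symmetric] by (rule norm_triangle_ineq4)
  ultimately show ?thesis using diam[OF X_in[of \<omega>] Y_in[of \<omega>]] by simp
qed

lemma step_transport_cost:
  "(\<integral>\<omega>. (norm (X \<omega> - (Y \<omega> + t *\<^sub>R residual \<omega>)))\<^sup>2 \<partial>P) =
    (\<integral>\<omega>. (norm (X \<omega> - Y \<omega>))\<^sup>2 \<partial>P) - 2 * t * (\<integral>\<omega>. residual \<omega> \<bullet> (X \<omega> - Y \<omega>) \<partial>P)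
    + t\<^sup>2 * (\<integral>\<omega>. (norm (residual \<omega>))\<^sup>2 \<partial>P)"
proof -
  have int1: "integrable P (\<lambda>\<omega>. (norm (X \<omega> - Y \<omega>))\<^sup>2)"
    by (rule integrable_const_bound[where B = "D\<^sup>2"]) (use diam[OF X_in Y_in] in \<open>auto intro!: power_mono\<close>)
  have int2: "integrable P (\<lambda>\<omega>. residual \<omega> \<bullet> (X \<omega> - Y \<omega>))"
    by (rule integrable_const_bound[where B = "(D + 4 * (B * D)) * D"])
      (use diam[OF X_in Y_in] residual_bound D_nonneg B_nonneg in
        \<open>auto intro!: order_trans[OF Cauchy_Schwarz_ineq2] mult_mono\<close>)
  have int3: "integrable P (\<lambda>\<omega>. (norm (residual \<omega>))\<^sup>2)"
    by (rule integrable_const_bound[where B = "(D + 4 * (B * D))\<^sup>2"])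
      (use residual_bound in \<open>auto intro!: power_mono\<close>)
  have "(norm (X \<omega> - (Y \<omega> + t *\<^sub>R residual \<omega>)))\<^sup>2 =
      (norm (X \<omega> - Y \<omega>))\<^sup>2 - 2 * t * (residual \<omega> \<bullet> (X \<omega> - Y \<omega>)) + t\<^sup>2 * (norm (residual \<omega>))\<^sup>2" for \<omega>
    unfolding power2_norm_eq_inner
    by (simp add: inner_diff_left inner_diff_right inner_add_left inner_add_right inner_commute
        algebra_simps power2_eq_square)
  then show ?thesis using int1 int2 int3 by simp
qed

text \<open>
  Taylor expansion of \<open>V\<close> at \<open>|w|\<^sup>2\<close> along \<open>w + t m\<close>, where \<open>w\<close> is the difference of the two positions
  and \<open>m\<close> that of the residuals. With \<open>|w| \<le> D\<close> and \<open>|m| \<le> 2 N\<close>, everything beyond first order in \<open>t\<close> is bounded by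
  a constant times \<open>t\<^sup>2\<close>. Both squared distances lie in the range where the Taylor bound holds, because
  the moved points are still in \<open>\<Omega>\<close>.
\<close>
lemma step_interaction_pointwise:
  assumes t: "0 \<le> t" "t * (1 + 4 * B) \<le> 1"
  defines "N \<equiv> D + 4 * (B * D)"
  shows "V ((norm ((Y \<omega> + t *\<^sub>R residual \<omega>) - (Y \<omega>' + t *\<^sub>R residual \<omega>')))\<^sup>2) \<le>
    V ((norm (Y \<omega> - Y \<omega>'))\<^sup>2) + 2 * t * (force (Y \<omega> - Y \<omega>') \<bullet> (residual \<omega> - residual \<omega>'))
    + t\<^sup>2 * (B * (2 * N)\<^sup>2 + M * (2 * (D * (2 * N)) + (2 * N)\<^sup>2)\<^sup>2)"
proof -
  define w where "w = Y \<omega> - Y \<omega>'"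
  define m where "m = residual \<omega> - residual \<omega>'"
  have N: "0 \<le> N" using D_nonneg B_nonneg by (simp add: N_def)
  have t1: "t \<le> 1" using t mult_left_mono[of 1 "1 + 4 * B" t] B_nonneg by simp
  have w: "norm w \<le> D" unfolding w_def by (rule diam[OF Y_in Y_in])
  have m: "norm m \<le> 2 * N"
    unfolding m_def N_def using residual_bound[of \<omega>] residual_bound[of \<omega>']
    by (intro order_trans[OF norm_triangle_ineq4]) simp
  have wm: "\<bar>w \<bullet> m\<bar> \<le> D * (2 * N)"
    using w m D_nonneg by (intro order_trans[OF Cauchy_Schwarz_ineq2] mult_mono) auto
  have m2: "(norm m)\<^sup>2 \<le> (2 * N)\<^sup>2" using m by (intro power_mono) auto
  have in\<Omega>: "Y \<omega> + t *\<^sub>R residual \<omega> \<in> \<Omega>" for \<omega>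
    unfolding residual_def by (rule descent_step_in[OF X_in Y_in t])
  have diff: "(Y \<omega> + t *\<^sub>R residual \<omega>) - (Y \<omega>' + t *\<^sub>R residual \<omega>') = w + t *\<^sub>R m"
    by (simp add: w_def m_def algebra_simps)
  define s where "s = (norm w)\<^sup>2"
  define u where "u = (norm (w + t *\<^sub>R m))\<^sup>2"
  have s: "s \<in> {0..D\<^sup>2}" unfolding s_def w_def by (rule sq_in[OF Y_in Y_in])
  have u: "u \<in> {0..D\<^sup>2}" unfolding u_def diff[symmetric] by (rule sq_in[OF in\<Omega> in\<Omega>])
  have us: "u - s = 2 * t * (w \<bullet> m) + t\<^sup>2 * (norm m)\<^sup>2"
    unfolding u_def s_def power2_norm_eq_inner
    by (simp add: inner_add_left inner_add_right inner_commute algebra_simps power2_eq_square)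
  have V's: "0 \<le> V' s" "V' s \<le> B" using V'_nonneg V'_le[OF s] s by auto
  have tt: "t\<^sup>2 \<le> t" using t1 t(1) by (simp add: power2_eq_square mult_left_le)
  have "\<bar>u - s\<bar> \<le> \<bar>2 * t * (w \<bullet> m)\<bar> + \<bar>t\<^sup>2 * (norm m)\<^sup>2\<bar>"
    unfolding us by (rule abs_triangle_ineq)
  also have "\<dots> = t * (2 * \<bar>w \<bullet> m\<bar>) + t\<^sup>2 * (norm m)\<^sup>2"
    using t by (simp add: abs_mult)
  also have "\<dots> \<le> t * (2 * (D * (2 * N))) + t * (2 * N)\<^sup>2"
    using wm m2 t tt by (intro add_mono mult_mono) auto
  finally have "\<bar>u - s\<bar> \<le> t * (2 * (D * (2 * N)) + (2 * N)\<^sup>2)" by (simp add: distrib_left)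
  then have "\<bar>u - s\<bar>\<^sup>2 \<le> (t * (2 * (D * (2 * N)) + (2 * N)\<^sup>2))\<^sup>2"
    by (rule power_mono) simp
  then have sq: "M * (u - s)\<^sup>2 \<le> t\<^sup>2 * (M * (2 * (D * (2 * N)) + (2 * N)\<^sup>2)\<^sup>2)"
    using mult_left_mono[OF _ M_nonneg] by (simp add: power_mult_distrib mult.left_commute)
  have "V' s * (t\<^sup>2 * (norm m)\<^sup>2) \<le> B * (t\<^sup>2 * (2 * N)\<^sup>2)"
    using V's m2 B_nonneg by (intro mult_mono) auto
  then have lin: "V' s * (u - s) \<le> 2 * t * (V' s * (w \<bullet> m)) + t\<^sup>2 * (B * (2 * N)\<^sup>2)"
    unfolding us by (simp add: algebra_simps)
  have "V u \<le> V s + V' s * (u - s) + M * (u - s)\<^sup>2" by (rule V_taylor[OF s u])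
  also have "\<dots> \<le> V s + (2 * t * (V' s * (w \<bullet> m)) + t\<^sup>2 * (B * (2 * N)\<^sup>2))
      + t\<^sup>2 * (M * (2 * (D * (2 * N)) + (2 * N)\<^sup>2)\<^sup>2)"
    using lin sq by (intro add_mono) auto
  finally have "V u \<le> V s + 2 * t * (V' s * (w \<bullet> m))
      + t\<^sup>2 * (B * (2 * N)\<^sup>2 + M * (2 * (D * (2 * N)) + (2 * N)\<^sup>2)\<^sup>2)"
    by (simp add: distrib_left)
  then show ?thesis
    unfolding diff u_def s_def by (simp add: w_def m_def)
qed

text \<open>
  The force is odd, so the two particles contribute equally, and integrating out one of them
  produces the integral in the definition of \<open>optimal_source\<close>.
\<close>
lemma interaction_first_variation:
  "integrable (P \<Otimes>\<^sub>M P) (\<lambda>z. force (Y (fst z) - Y (snd z)) \<bullet> (residual (fst z) - residual (snd z)))"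
  "2 * (\<integral>z. force (Y (fst z) - Y (snd z)) \<bullet> (residual (fst z) - residual (snd z)) \<partial>(P \<Otimes>\<^sub>M P))
    = (\<integral>\<omega>. residual \<omega> \<bullet> (source (Y \<omega>) - Y \<omega>) \<partial>P)"
proof -
  define h where "h z = force (Y (fst z) - Y (snd z)) \<bullet> residual (fst z)" for z
  have "(\<lambda>w. force w) \<in> borel_measurable borel" by measurable
  then have [measurable]: "(\<lambda>z. force (Y (fst z) - Y (snd z))) \<in> borel_measurable (P \<Otimes>\<^sub>M P)"
    by (rule measurable_compose[rotated]) measurable
  have hm[measurable]: "h \<in> borel_measurable (P \<Otimes>\<^sub>M P)"
    unfolding h_def[abs_def] by measurable
  have h_int: "integrable (P \<Otimes>\<^sub>M P) h"
  proof (rule PP.P.integrable_const_bound[where B = "(B * D) * (D + 4 * (B * D))"])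
    show "AE z in P \<Otimes>\<^sub>M P. norm (h z) \<le> (B * D) * (D + 4 * (B * D))"
      unfolding h_def real_norm_def using force_bound[OF Y_in Y_in] residual_bound D_nonneg B_nonneg
      by (intro AE_I2 order_trans[OF Cauchy_Schwarz_ineq2] mult_mono) auto
  qed measurable
  have swap: "(\<integral>z. h (snd z, fst z) \<partial>(P \<Otimes>\<^sub>M P)) = (\<integral>z. h z \<partial>(P \<Otimes>\<^sub>M P))"
    using PP.integral_product_swap[OF hm] unfolding case_prod_beta' by simp
  have swap_int: "integrable (P \<Otimes>\<^sub>M P) (\<lambda>z. h (snd z, fst z))"
    using PP.integrable_product_swap[OF h_int] unfolding case_prod_beta' by simp
  have split: "force (Y (fst z) - Y (snd z)) \<bullet> (residual (fst z) - residual (snd z)) = h z + h (snd z, fst z)" for z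
  proof -
    have "force (Y (snd z) - Y (fst z)) = - force (Y (fst z) - Y (snd z))"
      by (simp add: norm_minus_commute algebra_simps)
    then show ?thesis unfolding h_def by (simp add: inner_diff_right)
  qed
  show "integrable (P \<Otimes>\<^sub>M P) (\<lambda>z. force (Y (fst z) - Y (snd z)) \<bullet> (residual (fst z) - residual (snd z)))"
    unfolding split using h_int swap_int by simp
  have "(\<integral>z. h z \<partial>(P \<Otimes>\<^sub>M P)) = (\<integral>\<omega>. (\<integral>\<omega>'. h (\<omega>, \<omega>') \<partial>P) \<partial>P)"
    by (rule PP.integral_fst'[OF h_int, symmetric])
  also have "\<dots> = (\<integral>\<omega>. (residual \<omega> \<bullet> (source (Y \<omega>) - Y \<omega>)) / 4 \<partial>P)"
  proof (rule Bochner_Integration.integral_cong[OF refl])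
    fix \<omega>
    have "(\<integral>\<omega>'. h (\<omega>, \<omega>') \<partial>P) = (\<integral>\<omega>'. force (Y \<omega> - Y \<omega>') \<partial>P) \<bullet> residual \<omega>"
      unfolding h_def fst_conv snd_conv by (rule integral_inner_left) (rule force_integrable[OF Y_in])
    then show "(\<integral>\<omega>'. h (\<omega>, \<omega>') \<partial>P) = (residual \<omega> \<bullet> (source (Y \<omega>) - Y \<omega>)) / 4"
      by (simp add: optimal_source_def inner_commute)
  qed
  finally have "4 * (\<integral>z. h z \<partial>(P \<Otimes>\<^sub>M P)) = (\<integral>\<omega>. residual \<omega> \<bullet> (source (Y \<omega>) - Y \<omega>) \<partial>P)"
    by simp
  then show "2 * (\<integral>z. force (Y (fst z) - Y (snd z)) \<bullet> (residual (fst z) - residual (snd z)) \<partial>(P \<Otimes>\<^sub>M P))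
    = (\<integral>\<omega>. residual \<omega> \<bullet> (source (Y \<omega>) - Y \<omega>) \<partial>P)"
    unfolding split using h_int swap_int swap by simp
qed

text \<open>
  The first-order terms of transport and interaction combine to \<open>- t\<close> times the expectation of
  \<open>residual \<bullet> ((X - Y) - (source (Y) - Y))\<close>, which is the squared residual.
\<close>
lemma step_plan_cost:
  obtains K where "K \<ge> 0" "\<And>t. 0 \<le> t \<Longrightarrow> t * (1 + 4 * B) \<le> 1 \<Longrightarrow>
    plan_cost V P X (\<lambda>\<omega>. Y \<omega> + t *\<^sub>R residual \<omega>) \<le>
      plan_cost V P X Y - t * (\<integral>\<omega>. (norm (residual \<omega>))\<^sup>2 \<partial>P) + t\<^sup>2 * K"
proof -
  define N where "N = D + 4 * (B * D)"
  define K1 where "K1 = B * (2 * N)\<^sup>2 + M * (2 * (D * (2 * N)) + (2 * N)\<^sup>2)\<^sup>2"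
  have N: "0 \<le> N" using D_nonneg B_nonneg by (simp add: N_def)
  have K1: "0 \<le> K1" using B_nonneg M_nonneg by (simp add: K1_def)
  let ?E = "\<integral>\<omega>. (norm (residual \<omega>))\<^sup>2 \<partial>P"
  have res_int: "integrable P (\<lambda>\<omega>. (norm (residual \<omega>))\<^sup>2)"
    by (rule integrable_const_bound[where B = "N\<^sup>2"])
      (use residual_bound in \<open>auto intro!: power_mono simp: N_def\<close>)
  obtain C where C: "\<And>s. s \<in> {0..D\<^sup>2} \<Longrightarrow> \<bar>V s\<bar> \<le> C"
    using compact_imp_bounded[OF compact_continuous_image[OF continuous_on_subset[OF contV], of "{0..D\<^sup>2}"]]
    unfolding bounded_iff by fastforce
  have V_int: "integrable (P \<Otimes>\<^sub>M P) (\<lambda>z. V ((norm (Z (fst z) - Z (snd z)))\<^sup>2))"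
    if Z[measurable]: "Z \<in> borel_measurable P" and Z_in: "\<And>\<omega>. Z \<omega> \<in> \<Omega>" for Z
  proof (rule PP.P.integrable_const_bound[where B = C])
    show "(\<lambda>z. V ((norm (Z (fst z) - Z (snd z)))\<^sup>2)) \<in> borel_measurable (P \<Otimes>\<^sub>M P)"
      by (rule measurable_compose[OF _ V_measurable]) measurable
  qed (use C[OF sq_in[OF Z_in Z_in]] in auto)
  show thesis
  proof (rule that)
    show "0 \<le> N\<^sup>2 / 2 + K1" using K1 by simp
    fix t :: real assume t: "0 \<le> t" "t * (1 + 4 * B) \<le> 1"
    have in\<Omega>: "Y \<omega> + t *\<^sub>R residual \<omega> \<in> \<Omega>" for \<omega>
      unfolding residual_def by (rule descent_step_in[OF X_in Y_in t])
    have "(\<integral>z. V ((norm ((Y (fst z) + t *\<^sub>R residual (fst z)) - (Y (snd z) + t *\<^sub>R residual (snd z))))\<^sup>2) \<partial>(P \<Otimes>\<^sub>M P))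
      \<le> (\<integral>z. V ((norm (Y (fst z) - Y (snd z)))\<^sup>2)
        + 2 * t * (force (Y (fst z) - Y (snd z)) \<bullet> (residual (fst z) - residual (snd z))) + t\<^sup>2 * K1 \<partial>(P \<Otimes>\<^sub>M P))"
    proof (rule integral_mono)
      show "integrable (P \<Otimes>\<^sub>M P)
        (\<lambda>z. V ((norm ((Y (fst z) + t *\<^sub>R residual (fst z)) - (Y (snd z) + t *\<^sub>R residual (snd z))))\<^sup>2))"
        by (rule V_int[OF _ in\<Omega>]) measurable
    qed (use V_int[OF Y_measurable Y_in] interaction_first_variation(1)
          step_interaction_pointwise[OF t] in \<open>auto simp: K1_def N_def\<close>)
    also have "\<dots> = (\<integral>z. V ((norm (Y (fst z) - Y (snd z)))\<^sup>2) \<partial>(P \<Otimes>\<^sub>M P))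
        + t * (\<integral>\<omega>. residual \<omega> \<bullet> (source (Y \<omega>) - Y \<omega>) \<partial>P) + t\<^sup>2 * K1"
      using V_int[OF Y_measurable Y_in] interaction_first_variation
      by (simp add: PP.P.prob_space)
    finally have "plan_cost V P X (\<lambda>\<omega>. Y \<omega> + t *\<^sub>R residual \<omega>) \<le> plan_cost V P X Y
        - t * ((\<integral>\<omega>. residual \<omega> \<bullet> (X \<omega> - Y \<omega>) \<partial>P) - (\<integral>\<omega>. residual \<omega> \<bullet> (source (Y \<omega>) - Y \<omega>) \<partial>P))
        + t\<^sup>2 * (?E / 2 + K1)"
      unfolding plan_cost_def step_transport_cost by (simp add: algebra_simps)
    also have "(\<integral>\<omega>. residual \<omega> \<bullet> (X \<omega> - Y \<omega>) \<partial>P) - (\<integral>\<omega>. residual \<omega> \<bullet> (source (Y \<omega>) - Y \<omega>) \<partial>P) = ?E"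
    proof -
      have b: "norm (source (Y \<omega>) - Y \<omega>) \<le> N + D" for \<omega>
      proof -
        have eq: "source (Y \<omega>) - Y \<omega> = (X \<omega> - Y \<omega>) - residual \<omega>" by (simp add: residual_def)
        show ?thesis
          unfolding eq using norm_triangle_ineq4[of "X \<omega> - Y \<omega>" "residual \<omega>"] diam[OF X_in[of \<omega>] Y_in[of \<omega>]]
            residual_bound[of \<omega>] by (simp add: N_def)
      qed
      have "integrable P (\<lambda>\<omega>. residual \<omega> \<bullet> (X \<omega> - Y \<omega>))"
        by (rule integrable_const_bound[where B = "N * D"])
          (use diam[OF X_in Y_in] residual_bound N in
            \<open>auto intro!: order_trans[OF Cauchy_Schwarz_ineq2] mult_mono simp: N_def\<close>)
      moreover have "integrable P (\<lambda>\<omega>. residual \<omega> \<bullet> (source (Y \<omega>) - Y \<omega>))"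
        by (rule integrable_const_bound[where B = "N * (N + D)"])
          (use b residual_bound N in
            \<open>auto intro!: order_trans[OF Cauchy_Schwarz_ineq2] mult_mono simp: N_def\<close>)
      ultimately have "(\<integral>\<omega>. residual \<omega> \<bullet> (X \<omega> - Y \<omega>) \<partial>P) - (\<integral>\<omega>. residual \<omega> \<bullet> (source (Y \<omega>) - Y \<omega>) \<partial>P)
          = (\<integral>\<omega>. residual \<omega> \<bullet> (X \<omega> - Y \<omega>) - residual \<omega> \<bullet> (source (Y \<omega>) - Y \<omega>) \<partial>P)"
        by simp
      also have "\<dots> = ?E"
        by (rule Bochner_Integration.integral_cong)
          (simp_all add: residual_def power2_norm_eq_inner flip: inner_diff_right)
      finally show ?thesis .
    qed
    finally have "plan_cost V P X (\<lambda>\<omega>. Y \<omega> + t *\<^sub>R residual \<omega>) \<le>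
      plan_cost V P X Y - t * ?E + t\<^sup>2 * (?E / 2 + K1)" .
    moreover have "?E \<le> N\<^sup>2"
      by (rule integral_le_const[OF res_int]) (use residual_bound in \<open>auto intro!: power_mono simp: N_def\<close>)
    then have "t\<^sup>2 * (?E / 2 + K1) \<le> t\<^sup>2 * (N\<^sup>2 / 2 + K1)" by (intro mult_left_mono) auto
    ultimately show "plan_cost V P X (\<lambda>\<omega>. Y \<omega> + t *\<^sub>R residual \<omega>) \<le>
      plan_cost V P X Y - t * ?E + t\<^sup>2 * (N\<^sup>2 / 2 + K1)"
      by linarith
  qed
qed

text \<open>
  For a minimal pair the descent estimate leaves \<open>E |residual|\<^sup>2 \<le> t K\<close> for all small \<open>t\<close>.
\<close>
lemma source_eq_of_minimal:
  assumes min: "\<And>Z. transport_pair \<Omega> \<mu> P X Z \<Longrightarrow> plan_cost V P X Y \<le> plan_cost V P X Z"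
  shows "AE \<omega> in P. X \<omega> = source (Y \<omega>)"
proof -
  let ?E = "\<integral>\<omega>. (norm (residual \<omega>))\<^sup>2 \<partial>P"
  obtain K where K: "K \<ge> 0" "\<And>t. 0 \<le> t \<Longrightarrow> t * (1 + 4 * B) \<le> 1 \<Longrightarrow>
    plan_cost V P X (\<lambda>\<omega>. Y \<omega> + t *\<^sub>R residual \<omega>) \<le> plan_cost V P X Y - t * ?E + t\<^sup>2 * K"
    by (rule step_plan_cost, rule that)
  have "?E \<le> e" if e: "e > 0" for e
  proof -
    \<comment> \<open>The first bound keeps the step inside \<open>\<Omega>\<close>, the second makes \<open>t K \<le> e\<close>.\<close>
    define t where "t = min (1 / (1 + 4 * B)) (e / (K + 1))"
    have B1: "0 < 1 + 4 * B" using B_nonneg by simp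
    have t: "0 < t" using B1 K(1) e by (simp add: t_def)
    have "t \<le> 1 / (1 + 4 * B)" by (simp add: t_def)
    then have t': "t * (1 + 4 * B) \<le> 1" using B1 by (simp add: pos_le_divide_eq)
    have "Y \<omega> + t *\<^sub>R residual \<omega> \<in> \<Omega>" for \<omega>
      unfolding residual_def by (rule descent_step_in[OF X_in Y_in]) (use t t' in auto)
    then have "transport_pair \<Omega> \<mu> P X (\<lambda>\<omega>. Y \<omega> + t *\<^sub>R residual \<omega>)"
      using pair by (simp add: transport_pair_def)
    from min[OF this] K(2)[of t] t t' have "t * ?E \<le> t\<^sup>2 * K" by linarith
    also have "t\<^sup>2 * K = t * (t * K)" by (simp add: power2_eq_square)
    finally have "t * ?E \<le> t * (t * K)" .
    then have "?E \<le> t * K" using t by simp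
    also have "\<dots> \<le> e / (K + 1) * K" using K(1) by (intro mult_right_mono) (auto simp: t_def)
    also have "\<dots> \<le> e" using K(1) e by (simp add: field_simps)
    finally show ?thesis .
  qed
  then have "?E \<le> 0" by (rule field_le_epsilon[of _ 0, simplified])
  moreover have "0 \<le> ?E" by simp
  ultimately have E0: "?E = 0" by simp
  have "integrable P (\<lambda>\<omega>. (norm (residual \<omega>))\<^sup>2)"
    by (rule integrable_const_bound[where B = "(D + 4 * (B * D))\<^sup>2"])
      (use residual_bound in \<open>auto intro!: power_mono\<close>)
  from integral_nonneg_eq_0_iff_AE[OF this] E0 have "AE \<omega> in P. (norm (residual \<omega>))\<^sup>2 = 0" by simp
  then show ?thesis by eventually_elim (simp add: residual_def)
qed

end

section \<open>Bounded densities\<close>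

text \<open>
  A bounded Borel set is covered, up to a small excess of Lebesgue measure, by countably many cubes
  with disjoint interiors. Only the interiors are disjoint, but each cube has the same Lebesgue
  measure as its interior, while for \<open>\<nu>\<close> subadditivity suffices.
\<close>
lemma emeasure_le_of_cube_bound:
  fixes \<nu> :: "'a::euclidean_space measure"
  assumes sets\<nu>: "sets \<nu> = sets borel"
    and cubes: "\<And>u v h. 0 < h \<Longrightarrow> (\<And>i. i \<in> Basis \<Longrightarrow> v \<bullet> i - u \<bullet> i = h) \<Longrightarrow>
      emeasure \<nu> (cbox u v) \<le> C * emeasure lborel (cbox u v)"
    and A: "A \<in> sets borel" "bounded A" and C: "C < \<infinity>"
  shows "emeasure \<nu> A \<le> C * emeasure lborel A"
proof -
  have bound: "emeasure \<nu> A \<le> C * (emeasure lborel A + ennreal e)" if e: "e > 0" for e :: real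
  proof -
    obtain c where c: "c > 0" "A \<subseteq> cbox (- c *\<^sub>R One) (c *\<^sub>R One)"
      using bounded_subset_cbox_symmetric
    proof -
      obtain R where R: "R > 0" "\<And>x. x \<in> A \<Longrightarrow> norm x < R" using A(2) bounded_pos_less by blast
      have "x \<in> cbox (- R *\<^sub>R One) (R *\<^sub>R One)" if "x \<in> A" for x
        using R(2)[OF that] by (auto simp: mem_box dest!: Basis_le_norm[of _ x])
      then show thesis using that[of R] R(1) by blast
    qed
    have lm: "A \<in> lmeasurable"
      by (rule bounded_set_imp_lmeasurable) (use A in auto)
    obtain \<D> where "countable \<D>"
      and box: "\<And>K. K \<in> \<D> \<Longrightarrow> K \<subseteq> cbox (- c *\<^sub>R One) (c *\<^sub>R One) \<and> K \<noteq> {} \<and> (\<exists>c d. K = cbox c d)"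
      and pw: "pairwise (\<lambda>A B. interior A \<inter> interior B = {}) \<D>"
      and side: "\<And>u v. cbox u v \<in> \<D> \<Longrightarrow> \<exists>n. \<forall>i\<in>Basis. v \<bullet> i - u \<bullet> i = ((c *\<^sub>R One) \<bullet> i - (- c *\<^sub>R One) \<bullet> i) / 2 ^ n"
      and cover: "A \<subseteq> \<Union>\<D>" and Dm: "\<Union>\<D> \<in> lmeasurable"
      and meas: "measure lebesgue (\<Union>\<D>) \<le> measure lebesgue A + e"
      by (rule measurable_outer_intervals_bounded[OF lm c(2) e], rule that)
    \<comment> \<open>Enumerate the cubes without repetition, padding with empty sets, so that one argument covers
      finite and infinite covers.\<close>
    obtain g :: "'a set \<Rightarrow> nat" where g: "inj_on g \<D>" using countableE[OF \<open>countable \<D>\<close>] by blast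
    define f where "f i = (if i \<in> g ` \<D> then inv_into \<D> g i else {})" for i
    have fg: "f (g K) = K" if "K \<in> \<D>" for K
      using that g by (simp add: f_def)
    have fD: "f i = {} \<or> f i \<in> \<D> \<and> g (f i) = i" for i
      unfolding f_def by (simp add: inv_into_into f_inv_into_f)
    have f_cube: "f i \<in> sets borel \<and> emeasure \<nu> (f i) \<le> C * emeasure lborel (interior (f i))" for i
    proof (cases "f i = {}")
      case False
      then have D: "f i \<in> \<D>" using fD by blast
      then obtain u v where uv: "f i = cbox u v" using box by blast
      obtain n :: nat where n: "\<forall>i\<in>Basis. v \<bullet> i - u \<bullet> i = 2 * c / 2 ^ n"
        using side[of u v] D uv by auto
      have "emeasure \<nu> (cbox u v) \<le> C * emeasure lborel (cbox u v)"
        by (rule cubes[of "2 * c / 2 ^ n"]) (use c(1) n in auto)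
      moreover have "emeasure lborel (cbox u v) = emeasure lborel (box u v)"
        by (simp add: emeasure_lborel_cbox_eq emeasure_lborel_box_eq)
      ultimately show ?thesis by (simp add: uv interior_cbox)
    qed simp
    have disj: "disjoint_family (\<lambda>i. interior (f i))"
      unfolding disjoint_family_on_def
    proof (intro ballI impI)
      fix i j :: nat assume "i \<noteq> j"
      show "interior (f i) \<inter> interior (f j) = {}"
      proof (cases "f i = {} \<or> f j = {}")
        case False
        then have "f i \<in> \<D>" "f j \<in> \<D>" "f i \<noteq> f j" using fD \<open>i \<noteq> j\<close> by metis+
        then show ?thesis using pw by (auto simp: pairwise_def)
      qed auto
    qed
    have "emeasure \<nu> A \<le> emeasure \<nu> (\<Union>i. f i)"
      by (rule emeasure_mono) (use cover fg f_cube sets\<nu> in \<open>fastforce+\<close>)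
    also have "\<dots> \<le> (\<Sum>i. emeasure \<nu> (f i))"
      by (rule emeasure_subadditive_countably) (use f_cube sets\<nu> in auto)
    also have "\<dots> \<le> (\<Sum>i. C * emeasure lborel (interior (f i)))"
      by (rule suminf_le) (use f_cube in auto)
    also have "\<dots> = C * emeasure lborel (\<Union>i. interior (f i))"
      using disj by (simp add: ennreal_suminf_cmult suminf_emeasure image_subset_iff)
    also have "emeasure lborel (\<Union>i. interior (f i)) \<le> emeasure lebesgue (\<Union>\<D>)"
    proof -
      have "emeasure lborel (\<Union>i. interior (f i)) = emeasure lebesgue (\<Union>i. interior (f i))"
        by simp
      also have "\<dots> \<le> emeasure lebesgue (\<Union>\<D>)"
        by (rule emeasure_mono) (use fD interior_subset Dm in \<open>fastforce+\<close>)
      finally show ?thesis .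
    qed
    also have "\<dots> \<le> ennreal (measure lebesgue A + e)"
      using meas Dm by (simp add: emeasure_eq_measure2 ennreal_leI)
    also have "\<dots> = emeasure lborel A + ennreal e"
    proof -
      have "emeasure lebesgue A = emeasure lborel A" using A(1) by simp
      then show ?thesis using e emeasure_eq_measure2[OF lm] by (simp add: ennreal_plus)
    qed
    finally show ?thesis by (simp add: mult_left_mono)
  qed
  show ?thesis
  proof (rule ennreal_le_epsilon)
    fix e :: real assume e: "0 < e"
    obtain c where c: "C = ennreal c" "c \<ge> 0" using C by (cases C) auto
    have "emeasure \<nu> A \<le> C * (emeasure lborel A + ennreal (e / (c + 1)))"
      by (rule bound) (use e c in auto)
    also have "\<dots> = C * emeasure lborel A + ennreal (c * (e / (c + 1)))"
      using c e ennreal_mult[of c "e / (c + 1)"] by (simp add: distrib_left)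
    also have "ennreal (c * (e / (c + 1))) \<le> ennreal e"
      using c e by (intro ennreal_leI) (simp add: field_simps)
    finally show "emeasure \<nu> A \<le> C * emeasure lborel A + ennreal e"
      by (simp add: add_left_mono)
  qed
qed

text \<open>
  The Radon-Nikodym density exceeds \<open>C\<close> only on a null set: otherwise its integral over that set would
  violate the bound.
\<close>
lemma density_bounded_of_emeasure_le:
  assumes M: "finite_measure M" and sets: "sets N = sets M" and C: "0 \<le> C"
    and le: "\<And>A. A \<in> sets M \<Longrightarrow> emeasure N A \<le> ennreal C * emeasure M A"
  shows "absolutely_continuous M N"
    and "\<exists>f\<in>borel_measurable M. (AE x in M. 0 \<le> f x \<and> f x \<le> C) \<and> N = density M (\<lambda>x. ennreal (f x))"
proof -
  interpret finite_measure M by fact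
  show ac: "absolutely_continuous M N"
    unfolding absolutely_continuous_def
  proof
    fix A assume "A \<in> null_sets M"
    then have A: "A \<in> sets M" "emeasure M A = 0" by auto
    with le[OF A(1)] show "A \<in> null_sets N" by (simp add: null_sets_def sets)
  qed
  obtain f where f[measurable]: "f \<in> borel_measurable M" and N: "density M f = N"
    using Radon_Nikodym[OF ac sets] by blast
  define A where "A = {x \<in> space M. ennreal C < f x}"
  have A[measurable]: "A \<in> sets M" unfolding A_def by measurable
  \<comment> \<open>The excess of \<open>f\<close> over \<open>C\<close> integrates to \<open>N A - C * M A\<close>, which is 0 in truncated subtraction.\<close>
  have "(\<integral>\<^sup>+x. f x * indicator A x - ennreal C * indicator A x \<partial>M) =
      (\<integral>\<^sup>+x. f x * indicator A x \<partial>M) - (\<integral>\<^sup>+x. ennreal C * indicator A x \<partial>M)"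
  proof (rule nn_integral_diff)
    show "(\<integral>\<^sup>+x. ennreal C * indicator A x \<partial>M) \<noteq> \<infinity>"
      by (simp add: nn_integral_cmult_indicator ennreal_mult_eq_top_iff)
    show "AE x in M. ennreal C * indicator A x \<le> f x * indicator A x"
      by (auto simp: A_def indicator_def)
  qed measurable
  also have "\<dots> = emeasure N A - ennreal C * emeasure M A"
    using A by (simp add: emeasure_density nn_integral_cmult_indicator flip: N)
  also have "\<dots> = 0"
  proof -
    have "ennreal C * emeasure M A < top"
    proof -
      have "emeasure M A < top" by (metis emeasure_finite infinity_ennreal_def less_top)
      then show ?thesis by (simp add: ennreal_mult_less_top)
    qed
    with le[OF A] have "emeasure N A < top" by (rule order_le_less_trans)
    with le[OF A] show ?thesis by (simp add: diff_eq_0_iff_ennreal)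
  qed
  finally have "AE x in M. f x * indicator A x - ennreal C * indicator A x = 0"
    by (subst (asm) nn_integral_0_iff_AE) auto
  then have fC: "AE x in M. f x \<le> ennreal C"
    using AE_space
  proof eventually_elim
    case (elim x)
    show ?case
    proof (rule ccontr)
      assume "\<not> f x \<le> ennreal C"
      with elim show False by (simp add: A_def diff_eq_0_iff_ennreal)
    qed
  qed
  have "AE x in M. ennreal (enn2real (f x)) = f x"
    using fC by eventually_elim (auto intro!: ennreal_enn2real intro: le_less_trans)
  then have "N = density M (\<lambda>x. ennreal (enn2real (f x)))"
    unfolding N[symmetric] by (intro density_cong) auto
  moreover have "AE x in M. 0 \<le> enn2real (f x) \<and> enn2real (f x) \<le> C"
    using fC by eventually_elim (auto simp: C enn2real_leI)
  ultimately show "\<exists>f\<in>borel_measurable M. (AE x in M. 0 \<le> f x \<and> f x \<le> C) \<and> N = density M (\<lambda>x. ennreal (f x))"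
    by (intro bexI[of _ "\<lambda>x. enn2real (f x)"]) auto
qed

lemma emeasure_le_of_bounded_density:
  fixes \<mu> :: "'a::euclidean_space measure"
  assumes "ac_with_bounded_density \<Omega> \<mu>" and \<Omega>: "\<Omega> \<in> sets borel"
  obtains C :: real where "C \<ge> 0"
    "\<And>A. A \<in> sets borel \<Longrightarrow> emeasure \<mu> (A \<inter> \<Omega>) \<le> ennreal C * emeasure lborel (A \<inter> \<Omega>)"
proof -
  obtain f C0 where f: "f \<in> borel_measurable (restrict_space lborel \<Omega>)"
    and fC: "AE x in restrict_space lborel \<Omega>. 0 \<le> f x \<and> f x \<le> C0"
    and \<mu>: "\<mu> = density (restrict_space lborel \<Omega>) (\<lambda>x. ennreal (f x))"
    using assms(1) unfolding ac_with_bounded_density_def by blast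
  define C where "C = max C0 0"
  have "emeasure \<mu> (A \<inter> \<Omega>) \<le> ennreal C * emeasure lborel (A \<inter> \<Omega>)" if A: "A \<in> sets borel" for A
  proof -
    have A': "A \<inter> \<Omega> \<in> sets (restrict_space lborel \<Omega>)"
      using A \<Omega> by (auto simp: sets_restrict_space)
    have "emeasure \<mu> (A \<inter> \<Omega>) = (\<integral>\<^sup>+x. ennreal (f x) * indicator (A \<inter> \<Omega>) x \<partial>restrict_space lborel \<Omega>)"
      unfolding \<mu> using f A' by (simp add: emeasure_density)
    also have "\<dots> \<le> (\<integral>\<^sup>+x. ennreal C * indicator (A \<inter> \<Omega>) x \<partial>restrict_space lborel \<Omega>)"
    proof (rule nn_integral_mono_AE)
      show "AE x in restrict_space lborel \<Omega>.
          ennreal (f x) * indicator (A \<inter> \<Omega>) x \<le> ennreal C * indicator (A \<inter> \<Omega>) x"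
        using fC by eventually_elim (auto simp: C_def indicator_def intro!: ennreal_leI)
    qed
    also have "\<dots> = ennreal C * emeasure lborel (A \<inter> \<Omega>)"
      using A' \<Omega> by (simp add: nn_integral_cmult_indicator emeasure_restrict_space)
    finally show ?thesis .
  qed
  then show thesis using that[of C] by (simp add: C_def)
qed

lemma emeasure_lborel_cube:
  fixes u v :: "'a::euclidean_space"
  assumes "0 \<le> h" "\<And>i. i \<in> Basis \<Longrightarrow> v \<bullet> i - u \<bullet> i = h"
  shows "emeasure lborel (cbox u v) = ennreal (h ^ DIM('a))"
proof -
  have "u \<bullet> i \<le> v \<bullet> i" if "i \<in> Basis" for i using assms(2)[OF that] assms(1) by simp
  moreover have "(\<Prod>i\<in>Basis. (v - u) \<bullet> i) = (\<Prod>i\<in>(Basis::'a set). h)"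
    by (rule prod.cong) (simp_all add: inner_diff_left assms(2))
  ultimately show ?thesis by (simp add: emeasure_lborel_cbox_eq)
qed

text \<open>
  Since \<open>X = G(Y)\<close>, the event that \<open>Y\<close> lies in a cube of side \<open>h\<close> forces \<open>X\<close> into the cube of
  side \<open>2 * L * DIM('a) * h\<close> around the image of any one point. Comparing with a cube rather than with the image
  itself avoids measurability questions about \<open>G\<close>.
\<close>
lemma bounded_density_of_lipschitz_source:
  fixes \<Omega> :: "'a::euclidean_space set" and G :: "'a \<Rightarrow> 'a"
  assumes pair: "transport_pair \<Omega> \<mu> P X Y" and \<Omega>: "compact \<Omega>"
    and \<mu>: "ac_with_bounded_density \<Omega> \<mu>"
    and lip: "\<And>y z. y \<in> \<Omega> \<Longrightarrow> z \<in> \<Omega> \<Longrightarrow> norm (G y - G z) \<le> L * norm (y - z)" and L: "0 \<le> L"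
    and XG: "AE \<omega> in P. X \<omega> = G (Y \<omega>)"
  shows "ac_with_bounded_density \<Omega> (distr P (restrict_space borel \<Omega>) Y)"
proof -
  interpret prob_space P using pair by (simp add: transport_pair_def)
  have X[measurable]: "X \<in> borel_measurable P" and Y[measurable]: "Y \<in> borel_measurable P"
    and X_in: "\<And>\<omega>. X \<omega> \<in> \<Omega>" and Y_in: "\<And>\<omega>. Y \<omega> \<in> \<Omega>"
    and law: "distr P (restrict_space borel \<Omega>) X = \<mu>"
    using pair by (auto simp: transport_pair_def)
  have \<Omega>_borel: "\<Omega> \<in> sets borel" using \<Omega> by (simp add: borel_compact)
  obtain C where C: "C \<ge> 0"
    "\<And>A. A \<in> sets borel \<Longrightarrow> emeasure \<mu> (A \<inter> \<Omega>) \<le> ennreal C * emeasure lborel (A \<inter> \<Omega>)"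
    using emeasure_le_of_bounded_density[OF \<mu> \<Omega>_borel] by blast
  have X_law: "emeasure P (X -` A \<inter> space P) \<le> ennreal C * emeasure lborel A"
    if A: "A \<in> sets borel" for A
  proof -
    have "A \<inter> \<Omega> \<in> sets (restrict_space borel \<Omega>)"
      using A \<Omega>_borel by (auto simp: sets_restrict_space)
    then have "emeasure \<mu> (A \<inter> \<Omega>) = emeasure P (X -` (A \<inter> \<Omega>) \<inter> space P)"
      unfolding law[symmetric] by (intro emeasure_distr borel_measurable_restrictI X X_in)
    also have "X -` (A \<inter> \<Omega>) \<inter> space P = X -` A \<inter> space P" using X_in by auto
    finally have "emeasure P (X -` A \<inter> space P) \<le> ennreal C * emeasure lborel (A \<inter> \<Omega>)"
      using C(2)[OF A] by simp
    also have "\<dots> \<le> ennreal C * emeasure lborel A"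
      using A \<Omega>_borel by (intro mult_left_mono emeasure_mono) auto
    finally show ?thesis .
  qed
  define N where "N = distr P borel Y"
  define d where "d = 2 * L * DIM('a)"
  define C' where "C' = C * d ^ DIM('a)"
  have d: "0 \<le> d" and C': "0 \<le> C'" using L C(1) by (simp_all add: d_def C'_def)
  have cubes: "emeasure N (cbox u v) \<le> ennreal C' * emeasure lborel (cbox u v)"
    if h: "0 < h" and uv: "\<And>i. i \<in> Basis \<Longrightarrow> v \<bullet> i - u \<bullet> i = h" for u v h
  proof (cases "cbox u v \<inter> \<Omega> = {}")
    case True
    then have "Y -` cbox u v \<inter> space P = {}" using Y_in by auto
    then show ?thesis by (simp add: N_def emeasure_distr)
  next
    case False
    then obtain z where z: "z \<in> cbox u v" "z \<in> \<Omega>" by blast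
    define r where "r = L * (DIM('a) * h)"
    have r: "0 \<le> r" using L h by (simp add: r_def)
    have close: "G y \<in> cbox (G z - r *\<^sub>R One) (G z + r *\<^sub>R One)" if y: "y \<in> cbox u v" "y \<in> \<Omega>" for y
    proof -
      have "norm (y - z) \<le> (\<Sum>i\<in>Basis. \<bar>(y - z) \<bullet> i\<bar>)" by (rule norm_le_l1)
      also have "\<dots> \<le> (\<Sum>i\<in>(Basis::'a set). h)"
      proof (rule sum_mono)
        fix i :: 'a assume i: "i \<in> Basis"
        then have "u \<bullet> i \<le> y \<bullet> i" "y \<bullet> i \<le> v \<bullet> i" "u \<bullet> i \<le> z \<bullet> i" "z \<bullet> i \<le> v \<bullet> i"
          using y z by (auto simp: mem_box)
        then show "\<bar>(y - z) \<bullet> i\<bar> \<le> h" using uv[OF i] by (simp add: inner_diff_left)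
      qed
      finally have "norm (y - z) \<le> DIM('a) * h" by simp
      then have "norm (G y - G z) \<le> r"
        unfolding r_def using lip[OF y(2) z(2)] L by (meson mult_left_mono order_trans)
      then have "\<bar>(G y - G z) \<bullet> i\<bar> \<le> r" if "i \<in> Basis" for i
        using Basis_le_norm[OF that] order_trans by blast
      then show ?thesis by (fastforce simp: mem_box inner_diff_left inner_add_left abs_le_iff)
    qed
    have "emeasure N (cbox u v) = emeasure P (Y -` cbox u v \<inter> space P)"
      by (simp add: N_def emeasure_distr)
    also have "\<dots> \<le> emeasure P (X -` cbox (G z - r *\<^sub>R One) (G z + r *\<^sub>R One) \<inter> space P)"
      by (rule emeasure_mono_AE) (use XG in \<open>eventually_elim, use close Y_in in auto\<close>, measurable)
    also have "\<dots> \<le> ennreal C * emeasure lborel (cbox (G z - r *\<^sub>R One) (G z + r *\<^sub>R One))"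
      by (rule X_law) simp
    also have "emeasure lborel (cbox (G z - r *\<^sub>R One) (G z + r *\<^sub>R One)) = ennreal ((2 * r) ^ DIM('a))"
      by (rule emeasure_lborel_cube) (use r in \<open>auto simp: inner_diff_left inner_add_left\<close>)
    also have "2 * r = d * h" by (simp add: r_def d_def)
    also have "ennreal C * ennreal ((d * h) ^ DIM('a)) = ennreal C' * emeasure lborel (cbox u v)"
      using emeasure_lborel_cube[OF less_imp_le[OF h] uv] C(1) C' d h
      by (simp add: C'_def power_mult_distrib mult.assoc flip: ennreal_mult)
    finally show ?thesis .
  qed
  let ?\<nu> = "distr P (restrict_space borel \<Omega>) Y"
  let ?M = "restrict_space lborel \<Omega>"
  have le: "emeasure ?\<nu> A \<le> ennreal C' * emeasure ?M A" if A: "A \<in> sets ?M" for A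
  proof -
    have A': "A \<in> sets borel" "A \<subseteq> \<Omega>" using A \<Omega>_borel by (auto simp: sets_restrict_space)
    have "emeasure ?\<nu> A = emeasure N A"
      using A A' borel_measurable_restrictI[OF Y Y_in]
      by (simp add: N_def emeasure_distr sets_restrict_space)
    also have "\<dots> \<le> ennreal C' * emeasure lborel A"
      by (rule emeasure_le_of_cube_bound[OF _ cubes A'(1)])
        (use A'(2) compact_imp_bounded[OF \<Omega>] bounded_subset in \<open>auto simp: N_def\<close>)
    also have "emeasure lborel A = emeasure ?M A"
      using A' \<Omega>_borel by (simp add: emeasure_restrict_space)
    finally show ?thesis .
  qed
  have fin: "finite_measure ?M"
    using emeasure_bounded_finite[OF compact_imp_bounded[OF \<Omega>]] \<Omega>_borel
    by (intro finite_measureI) (simp add: emeasure_restrict_space space_restrict_space less_top)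
  have sets: "sets ?\<nu> = sets ?M" by (simp add: sets_restrict_space)
  show ?thesis
    unfolding ac_with_bounded_density_def
    using density_bounded_of_emeasure_le[OF fin sets C' le] by blast
qed


section \<open>Existence and regularity of minimizers\<close>

theorem theorem3p4:
  fixes \<Omega> :: "'a::euclidean_space set" and \<mu> :: "'a measure"
    and V V' V'' :: "real \<Rightarrow> real"
  assumes "compact \<Omega>" and "convex \<Omega>" and "interior \<Omega> \<noteq> {}"
    and "\<mu> \<in> borel_probs \<Omega>" and "ac_with_bounded_density \<Omega> \<mu>"
    and "\<And>t. t \<ge> 0 \<Longrightarrow> V t \<ge> 0"
    and "\<And>t. t \<ge> 0 \<Longrightarrow> (V has_real_derivative V' t) (at t within {0..})"
    and "\<And>t. t \<ge> 0 \<Longrightarrow> (V' has_real_derivative V'' t) (at t within {0..})"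
    and "continuous_on {0..} V''"
    and "\<And>t. t \<ge> 0 \<Longrightarrow> V' t > 0"
  shows "(\<exists>\<nu>. is_arg_min (functional_F \<Omega> V \<mu>) (\<lambda>\<nu>. \<nu> \<in> borel_probs \<Omega>) \<nu>) \<and>
         (\<forall>\<nu>. is_arg_min (functional_F \<Omega> V \<mu>) (\<lambda>\<nu>. \<nu> \<in> borel_probs \<Omega>) \<nu> \<longrightarrow>
              ac_with_bounded_density \<Omega> \<nu>)"
proof (intro conjI allI impI)
  have contV: "continuous_on {0..} V" and contV': "continuous_on {0..} V'"
    using assms(7,8) by (auto intro!: DERIV_continuous_on)
  show "\<exists>\<nu>. is_arg_min (functional_F \<Omega> V \<mu>) (\<lambda>\<nu>. \<nu> \<in> borel_probs \<Omega>) \<nu>"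
    by (rule minimizer_exists[OF assms(1,2,4) contV assms(6)])
  fix \<nu> assume min: "is_arg_min (functional_F \<Omega> V \<mu>) (\<lambda>\<nu>. \<nu> \<in> borel_probs \<Omega>) \<nu>"
  then have \<nu>: "\<nu> \<in> borel_probs \<Omega>" by (simp add: is_arg_min_def)
  obtain P :: "real measure" and X Y where pair: "transport_pair \<Omega> \<mu> P X Y"
    and law: "distr P (restrict_space borel \<Omega>) Y = \<nu>"
    and F_eq: "functional_F \<Omega> V \<mu> \<nu> = plan_cost V P X Y"
    by (rule functional_attained[OF assms(1,2,4) \<nu> contV])
  obtain D where D: "\<And>x y. x \<in> \<Omega> \<Longrightarrow> y \<in> \<Omega> \<Longrightarrow> norm (x - y) \<le> D"
    using diameter_bounded_bound[OF compact_imp_bounded[OF assms(1)]] by (metis dist_norm)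
  obtain B M where BM: "0 \<le> M" "\<And>s. s \<in> {0..D\<^sup>2} \<Longrightarrow> V' s \<le> B"
    "\<And>s u. s \<in> {0..D\<^sup>2} \<Longrightarrow> u \<in> {0..D\<^sup>2} \<Longrightarrow> \<bar>V' s - V' u\<bar> \<le> M * \<bar>s - u\<bar>"
    "\<And>s u. s \<in> {0..D\<^sup>2} \<Longrightarrow> u \<in> {0..D\<^sup>2} \<Longrightarrow> V u \<le> V s + V' s * (u - s) + M * (u - s)\<^sup>2"
    by (rule C2_potential_bounds[of V V' V'' "D\<^sup>2"], erule assms(7), erule assms(8),
      rule assms(9), rule zero_le_power2, rule that)
  have V'_nn: "0 \<le> V' s" if "s \<ge> 0" for s using assms(10)[OF that] by simp
  interpret interacting_pair \<Omega> \<mu> P X Y V V' D B M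
    by unfold_locales (use pair assms(1,2) D contV contV' BM V'_nn in auto)
  have "AE \<omega> in P. X \<omega> = source (Y \<omega>)"
  proof (rule source_eq_of_minimal)
    fix Z assume Z: "transport_pair \<Omega> \<mu> P X Z"
    have "plan_cost V P X Y \<le> functional_F \<Omega> V \<mu> (distr P (restrict_space borel \<Omega>) Z)"
      using min transport_pair_laws(2)[OF Z] unfolding F_eq[symmetric] by (force simp: is_arg_min_def)
    also have "\<dots> \<le> plan_cost V P X Z" by (rule functional_le_plan_cost[OF Z contV])
    finally show "plan_cost V P X Y \<le> plan_cost V P X Z" .
  qed
  then show "ac_with_bounded_density \<Omega> \<nu>"
    unfolding law[symmetric]
    by (rule bounded_density_of_lipschitz_source[OF pair assms(1,5) source_lipschitz, rotated -1])
      (use B_nonneg M_nonneg in auto)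
qed

end
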